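(* Let $C_3$ be the triangle graph, let $\Bbbk$ be a field, and let $H_{C_3}(u,s)$ be the bigraded Hilbert polynomial of the associated graded algebra of the squarefree edge algebra of $C_3$ with respect to the rank filtration. Then $$H_{C_3}(u,s)=1+3us+3u^2s^2+u^2s^3.$$ Moreover, the Negami polynomial of $C_3$ satisfies $$f(C_3;t,x,y)=t^3y^3\,H_{C_3}(t^{-1},x/y).$$
   Context: The Negami polynomial $f(G)=f(G;t,x,y)$ of a finite graph is the polynomial determined by $f(\overline K_n)=t^n$, where $\overline K_n$ is the edgeless graph on $n$ vertices, and $f(G)=x f(G/e)+y f(G-e)$ for any edge $e$, where $G/e$ and $G-e$ are the contraction and deletion of $e$ (contraction keeps any resulting loops and multiple edges; contracting a loop means deleting it). Let $G=C_3$ with edge set $E=\{e_1,e_2,e_3\}$. The squarefree edge algebra is $B_G=\Bbbk[z_1,z_2,z_3]/(z_1^2,z_2^2,z_3^2)$. For $A\subseteq E$ write $z_A=\prod_{e_i\in A}z_i$, and let $\rho(A)$ be the rank of $A$ in the graphic matroid of $G$, i.e. $\rho(A)=|V(G)|-k(A)$ with $k(A)$ the number of connected components of the spanning subgraph $(V(G),A)$. The rank filtration is $F_pB_G=\operatorname{span}_{\Bbbk}\{z_A:\rho(A)\le p\}$ for $p\ge 0$, with $F_{-1}B_G=0$. It is multiplicative, and the associated graded algebra is $\operatorname{gr}_F B_G=\bigoplus_{p\ge 0}F_pB_G/F_{p-1}B_G$. It also retains the ordinary polynomial degree (where $z_A$ has degree $|A|$), so it is bigraded, the class of $z_A$ having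 bidegree $(\rho(A),|A|)$. Its bigraded Hilbert polynomial is $H_G(u,s)=\sum_{p,d}\dim_{\Bbbk}(\operatorname{gr}_F B_G)_{p,d}\,u^ps^d$. *)

theory Defs
  imports
    "HOL-Algebra.QuotRing"
    "HOL-Library.Poly_Mapping"
    "HOL-Library.Groups_Big_Fun"
    "HOL-Computational_Algebra.Polynomial_Factorial"
    "Jordan_Normal_Form.VS_Connect"
begin

section \<open>Finite multigraphs and the Negami polynomial\<close>

text \<open>Undirected multigraphs with named edges; a singleton set of ends is a loop.\<close>

record ('v, 'e) mgraph =
  verts :: "'v set"
  edges :: "'e set"
  ends :: "'e \<Rightarrow> 'v set"

definition finite_mgraph :: "('v, 'e) mgraph \<Rightarrow> bool" where
  "finite_mgraph G \<longleftrightarrow> finite (verts G) \<and> finite (edges G) \<and>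
     (\<forall>e\<in>edges G. \<exists>u\<in>verts G. \<exists>v\<in>verts G. ends G e = {u, v})"

definition delete_edge :: "('v, 'e) mgraph \<Rightarrow> 'e \<Rightarrow> ('v, 'e) mgraph" where
  "delete_edge G e = G\<lparr>edges := edges G - {e}\<rparr>"

text \<open>Contraction moves the ends of \<open>e\<close> to one (arbitrary) end of \<open>e\<close> and removes only \<open>e\<close>.
  If \<open>e\<close> is a loop no vertex moves, so that contraction is deletion.\<close>

definition merge_ends :: "('v, 'e) mgraph \<Rightarrow> 'e \<Rightarrow> 'v \<Rightarrow> 'v" where
  "merge_ends G e v = (if v \<in> ends G e then (SOME w. w \<in> ends G e) else v)"

definition contract_edge :: "('v, 'e) mgraph \<Rightarrow> 'e \<Rightarrow> ('v, 'e) mgraph" where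
  "contract_edge G e =
     \<lparr>verts = merge_ends G e ` verts G, edges = edges G - {e},
      ends = (\<lambda>e'. merge_ends G e ` ends G e')\<rparr>"

text \<open>The ring \<open>\<int>[t,x,y]\<close> is rendered as \<open>\<int>[t][x][y]\<close>.\<close>

type_synonym poly_txy = "int poly poly poly"

definition var_t :: poly_txy where "var_t = [:[:[:0, 1:]:]:]"
definition var_x :: poly_txy where "var_x = [:[:0, 1:]:]"
definition var_y :: poly_txy where "var_y = [:0, 1:]"

definition is_negami :: "(('v, 'e) mgraph \<Rightarrow> poly_txy) \<Rightarrow> bool" where
  "is_negami f \<longleftrightarrow>
     (\<forall>G. finite_mgraph G \<and> edges G = {} \<longrightarrow> f G = var_t ^ card (verts G)) \<and>
     (\<forall>G e. finite_mgraph G \<and> e \<in> edges G \<longrightarrow>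
        f G = var_x * f (contract_edge G e) + var_y * f (delete_edge G e))"

text \<open>The recursion determines \<open>f\<close> on finite multigraphs only, so the description is of the
  value at \<open>G\<close>.\<close>

definition negami :: "('v, 'e) mgraph \<Rightarrow> poly_txy" where
  "negami G = (THE p. \<exists>f. is_negami f \<and> f G = p)"

definition triangle :: "(nat, nat) mgraph" where
  "triangle = \<lparr>verts = {0, 1, 2}, edges = {0, 1, 2}, ends = (\<lambda>i. {i, (i + 1) mod 3})\<rparr>"


section \<open>Rank in the graphic matroid\<close>

definition connected_rel :: "('v, 'e) mgraph \<Rightarrow> 'e set \<Rightarrow> ('v \<times> 'v) set" where
  "connected_rel G A = {(u, v). \<exists>e\<in>A. ends G e = {u, v}}\<^sup>* \<inter> verts G \<times> verts G"

definition num_components :: "('v, 'e) mgraph \<Rightarrow> 'e set \<Rightarrow> nat" where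
  "num_components G A = card (verts G // connected_rel G A)"

definition graph_rank :: "('v, 'e) mgraph \<Rightarrow> 'e set \<Rightarrow> nat" where
  "graph_rank G A = card (verts G) - num_components G A"


section \<open>The squarefree edge algebra\<close>

text \<open>A polynomial in variables indexed by \<open>'e\<close> maps exponent vectors to coefficients.\<close>

type_synonym ('e, 'k) mpoly = "('e \<Rightarrow>\<^sub>0 nat) \<Rightarrow>\<^sub>0 'k"

definition poly_ring :: "'e set \<Rightarrow> ('e, 'k::field) mpoly ring" where
  "poly_ring E = \<lparr>carrier = {p. \<forall>m\<in>Poly_Mapping.keys p. Poly_Mapping.keys m \<subseteq> E},
     mult = (*), one = 1, zero = 0, add = (+)\<rparr>"

definition const_poly :: "'k::field \<Rightarrow> ('e, 'k) mpoly" where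
  "const_poly c = Poly_Mapping.single 0 c"

definition var_poly :: "'e \<Rightarrow> ('e, 'k::field) mpoly" where
  "var_poly e = Poly_Mapping.single (Poly_Mapping.single e 1) 1"

definition square_ideal :: "'e set \<Rightarrow> ('e, 'k::field) mpoly set" where
  "square_ideal E = genideal (poly_ring E) {var_poly e ^ 2 | e. e \<in> E}"

definition edge_algebra :: "('v, 'e) mgraph \<Rightarrow> ('k::field, ('e, 'k) mpoly set) module" where
  "edge_algebra G =
     (let P = poly_ring (edges G); I = square_ideal (edges G); Q = P Quot I
      in ring.extend Q (module.fields (\<lambda>c X. (I +>\<^bsub>P\<^esub> const_poly c) \<otimes>\<^bsub>Q\<^esub> X)))"

definition edge_monomial :: "('v, 'e) mgraph \<Rightarrow> 'e set \<Rightarrow> ('e, 'k::field) mpoly set" where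
  "edge_monomial G A =
     square_ideal (edges G) +>\<^bsub>poly_ring (edges G)\<^esub> (\<Prod>e\<in>A. var_poly e)"

text \<open>Indexing by \<open>int\<close> gives \<open>F\<^sub>-\<^sub>1 = span {} = {0}\<close>.\<close>

definition rank_filtration :: "('v, 'e) mgraph \<Rightarrow> int \<Rightarrow> ('e, 'k::field) mpoly set set" where
  "rank_filtration G p = LinearCombinations.module.span class_ring (edge_algebra G :: ('k, _) module)
     {edge_monomial G A | A. A \<subseteq> edges G \<and> int (graph_rank G A) \<le> p}"

definition degree_part :: "('v, 'e) mgraph \<Rightarrow> nat \<Rightarrow> ('e, 'k::field) mpoly set set" where
  "degree_part G d = LinearCombinations.module.span class_ring (edge_algebra G :: ('k, _) module)
     {edge_monomial G A | A. A \<subseteq> edges G \<and> card A = d}"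


section \<open>The associated graded algebra of a filtered algebra\<close>

text \<open>The vector space \<open>F\<^sub>p/F\<^sub>p\<^sub>-\<^sub>1\<close> of cosets. The record type demands a multiplication and
  a unit, which are set to zero and play no role.\<close>

definition gr_piece ::
    "('k, 'b) module \<Rightarrow> (int \<Rightarrow> 'b set) \<Rightarrow> nat \<Rightarrow> ('k, 'b set) module" where
  "gr_piece B F p =
     \<lparr>carrier = {F (int p - 1) +>\<^bsub>B\<^esub> x | x. x \<in> F (int p)},
      mult = (\<lambda>_ _. F (int p - 1)), one = F (int p - 1),
      zero = F (int p - 1), add = set_add B,
      smult = (\<lambda>c X. \<Union>x\<in>X. F (int p - 1) +>\<^bsub>B\<^esub> (c \<odot>\<^bsub>B\<^esub> x))\<rparr>"

text \<open>The algebra \<open>\<Oplus>\<^sub>p F\<^sub>p/F\<^sub>p\<^sub>-\<^sub>1\<close>: families of finite support. The product of homogeneous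
  elements is \<open>(a + F\<^sub>i\<^sub>-\<^sub>1) (b + F\<^sub>j\<^sub>-\<^sub>1) = ab + F\<^sub>i\<^sub>+\<^sub>j\<^sub>-\<^sub>1\<close>.\<close>

definition assoc_graded ::
    "('k, 'b) module \<Rightarrow> (int \<Rightarrow> 'b set) \<Rightarrow> ('k, nat \<Rightarrow> 'b set) module" where
  "assoc_graded B F =
     \<lparr>carrier = {g. (\<forall>p. g p \<in> carrier (gr_piece B F p)) \<and>
                    finite {p. g p \<noteq> \<zero>\<^bsub>gr_piece B F p\<^esub>}},
      mult = (\<lambda>g h p. \<Oplus>\<^bsub>gr_piece B F p\<^esub> i\<in>{..p}.
                rcoset_mult B (F (int p - 1)) (g i) (h (p - i))),
      one = (\<lambda>p. if p = 0 then F (- 1) +>\<^bsub>B\<^esub> \<one>\<^bsub>B\<^esub> else \<zero>\<^bsub>gr_piece B F p\<^esub>),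
      zero = (\<lambda>p. \<zero>\<^bsub>gr_piece B F p\<^esub>),
      add = (\<lambda>g h p. g p \<oplus>\<^bsub>gr_piece B F p\<^esub> h p),
      smult = (\<lambda>c g p. c \<odot>\<^bsub>gr_piece B F p\<^esub> g p)\<rparr>"

text \<open>Given a further grading \<open>D\<close> of \<open>B\<close>, the component of bidegree \<open>(p,d)\<close> consists of the
  classes in \<open>F\<^sub>p/F\<^sub>p\<^sub>-\<^sub>1\<close> of the elements of \<open>F\<^sub>p \<inter> D\<^sub>d\<close>.\<close>

definition bigraded_part ::
    "('k, 'b) module \<Rightarrow> (int \<Rightarrow> 'b set) \<Rightarrow> (nat \<Rightarrow> 'b set) \<Rightarrow> nat \<Rightarrow> nat \<Rightarrow> (nat \<Rightarrow> 'b set) set" where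
  "bigraded_part B F D p d =
     {g \<in> carrier (assoc_graded B F).
        (\<forall>q. q \<noteq> p \<longrightarrow> g q = \<zero>\<^bsub>gr_piece B F q\<^esub>) \<and>
        (\<exists>x \<in> F (int p) \<inter> D d. g p = F (int p - 1) +>\<^bsub>B\<^esub> x)}"


section \<open>The bigraded Hilbert polynomial\<close>

text \<open>The ring \<open>\<int>[u,s]\<close> is rendered as \<open>\<int>[s][u]\<close>.\<close>

type_synonym poly_us = "int poly poly"

definition var_u :: poly_us where "var_u = [:0, 1:]"
definition var_s :: poly_us where "var_s = [:[:0, 1:]:]"

definition hilbert_poly :: "'k::field itself \<Rightarrow> ('v, 'e) mgraph \<Rightarrow> poly_us" where
  "hilbert_poly _ G =
     (let B = edge_algebra G :: ('k, _) module; F = rank_filtration G; D = degree_part G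
      in Sum_any (\<lambda>(p, d). of_nat (vectorspace.dim (class_ring :: 'k ring)
            ((assoc_graded B F)\<lparr>carrier := bigraded_part B F D p d\<rparr>)) * var_u ^ p * var_s ^ d))"

text \<open>The substitution \<open>u := a\<close>, \<open>s := b\<close>.\<close>

definition eval_us :: "poly_us \<Rightarrow> 'a::comm_ring_1 \<Rightarrow> 'a \<Rightarrow> 'a" where
  "eval_us H a b = poly (map_poly (\<lambda>c. poly (map_poly of_int c) b) H) a"

end

theory Submission
  imports Defs
begin

text \<open>The classes of the squarefree monomials \<open>z\<^sub>A\<close> form a basis of the edge algebra, and both
  the rank filtration and the degree grading are spanned by parts of this basis. Hence the
  component of bidegree \<open>(p, d)\<close> has the basis \<open>{z\<^sub>A. \<rho>(A) = p, |A| = d}\<close>, and the Hilbert polynomial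
  is \<open>\<Sum>\<^sub>A u\<^bsup>\<rho>(A)\<^esup> s\<^bsup>|A|\<^esup>\<close>. On the other side, deletion-contraction yields the subset expansion
  \<open>f(G) = \<Sum>\<^sub>A x\<^bsup>|A|\<^esup> y\<^bsup>|E| - |A|\<^esup> t\<^bsup>k(A)\<^esup>\<close>, because \<open>k\<close> of \<open>A\<close> in \<open>G/e\<close> is \<open>k\<close> of \<open>A \<union> {e}\<close> in \<open>G\<close>.
  For the triangle \<open>\<rho>(A) = min(2, |A|)\<close>.\<close>

section \<open>Vector spaces in coordinates\<close>

text \<open>\<open>V\<close> is a bare record here: its operations are only required to match
  pointwise operations on functions supported in \<open>S\<close>. The vector space axioms are
  transported along \<open>\<Phi>\<close>, so that the locale serves both for the edge algebra and
  for spaces whose elements are families of cosets.\<close>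

locale finite_coordinates =
  fixes V :: "('k::field, 'b) module" (structure)
    and S :: "'a set" and \<Phi> :: "'b \<Rightarrow> 'a \<Rightarrow> 'k"
  assumes finite_index: "finite S"
    and coord_bij: "bij_betw \<Phi> (carrier V) {f. \<forall>a. a \<notin> S \<longrightarrow> f a = 0}"
    and zero_mem: "\<zero> \<in> carrier V"
    and add_mem: "\<lbrakk>x \<in> carrier V; y \<in> carrier V\<rbrakk> \<Longrightarrow> x \<oplus> y \<in> carrier V"
    and smult_mem: "x \<in> carrier V \<Longrightarrow> c \<odot> x \<in> carrier V"
    and coord_zero: "\<Phi> \<zero> a = 0"
    and coord_add: "\<lbrakk>x \<in> carrier V; y \<in> carrier V\<rbrakk> \<Longrightarrow> \<Phi> (x \<oplus> y) a = \<Phi> x a + \<Phi> y a"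
    and coord_smult: "x \<in> carrier V \<Longrightarrow> \<Phi> (c \<odot> x) a = c * \<Phi> x a"
begin

lemma coord_eqI:
  "\<lbrakk>x \<in> carrier V; y \<in> carrier V; \<And>a. \<Phi> x a = \<Phi> y a\<rbrakk> \<Longrightarrow> x = y"
  using coord_bij by (auto simp: bij_betw_def inj_on_def fun_eq_iff)

lemma coord_outside: "\<lbrakk>x \<in> carrier V; a \<notin> S\<rbrakk> \<Longrightarrow> \<Phi> x a = 0"
  using coord_bij by (auto simp: bij_betw_def)

lemma coord_surj:
  assumes "\<And>a. a \<notin> S \<Longrightarrow> f a = 0"
  obtains x where "x \<in> carrier V" "\<Phi> x = f"
proof -
  have "f \<in> \<Phi> ` carrier V"
    using assms coord_bij by (auto simp: bij_betw_def)
  then show thesis using that by auto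
qed

text \<open>The identities are checked in coordinates. Negatives exist because every function
  supported in \<open>S\<close> is a coordinate function.\<close>

lemma abelian_group: "abelian_group V"
proof (rule abelian_groupI)
  fix x assume x: "x \<in> carrier V"
  then obtain y where "y \<in> carrier V" "\<Phi> y = (\<lambda>a. - \<Phi> x a)"
    using coord_outside coord_surj[of "\<lambda>a. - \<Phi> x a"] by auto
  then show "\<exists>y\<in>carrier V. y \<oplus> x = \<zero>"
    using x by (intro bexI[of _ y] coord_eqI) (auto simp: add_mem zero_mem coord_add coord_zero)
qed (auto intro!: coord_eqI simp: add_mem zero_mem coord_add coord_zero)

lemma vectorspace: "vectorspace class_ring V"
proof -
  have "module class_ring V"
  proof (rule moduleI)
    show "cring (class_ring :: 'k ring)" ..
  qed (auto intro!: abelian_group coord_eqI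
      simp: add_mem smult_mem coord_add coord_smult algebra_simps)
  then show ?thesis
    by (simp add: vectorspace_def class_field)
qed

sublocale vectorspace class_ring V
  by (rule vectorspace)

lemma coord_finsum:
  assumes "finite A" "f \<in> A \<rightarrow> carrier V"
  shows "\<Phi> (finsum V f A) a = (\<Sum>x\<in>A. \<Phi> (f x) a)"
  using assms
proof (induction A rule: finite_induct)
  case (insert x A)
  then have "f \<in> A \<rightarrow> carrier V" "f x \<in> carrier V" by auto
  with insert show ?case
    by (simp add: finsum_insert coord_add)
qed (simp add: coord_zero)

lemma coord_lincomb:
  assumes "finite A" "A \<subseteq> carrier V"
  shows "\<Phi> (lincomb c A) a = (\<Sum>v\<in>A. c v * \<Phi> v a)"
proof -
  have "\<Phi> (lincomb c A) a = (\<Sum>v\<in>A. \<Phi> (c v \<odot> v) a)"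
    unfolding lincomb_def using assms by (intro coord_finsum) (auto simp: smult_mem)
  then show ?thesis
    using assms by (simp add: coord_smult subset_iff)
qed

section \<open>Coordinate unit vectors, spans and independence\<close>

context
  fixes e :: "'a \<Rightarrow> 'b"
  assumes unit_mem: "\<And>a. a \<in> S \<Longrightarrow> e a \<in> carrier V"
    and coord_unit: "\<And>a b. a \<in> S \<Longrightarrow> \<Phi> (e a) b = (if b = a then 1 else 0)"
begin

lemma unit_inj: "inj_on e S"
proof (rule inj_onI)
  fix a b assume "a \<in> S" "b \<in> S" "e a = e b"
  then show "a = b"
    using coord_unit[of a a] coord_unit[of b a] by (auto split: if_splits)
qed

text \<open>A combination of the units indexed by \<open>T\<close> has zero coordinates off
  \<open>T\<close>; conversely, a vector with zero coordinates off \<open>T\<close> is the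
  combination of these units with its own coordinates as coefficients.\<close>

lemma span_units:
  assumes "T \<subseteq> S"
  shows "span (e ` T) = {x \<in> carrier V. \<forall>a. a \<notin> T \<longrightarrow> \<Phi> x a = 0}"
proof (intro equalityI subsetI)
  fix x assume "x \<in> span (e ` T)"
  then obtain c A where A: "finite A" "A \<subseteq> e ` T" and x: "x = lincomb c A"
    unfolding span_def by auto
  have AV: "A \<subseteq> carrier V" using A assms unit_mem by auto
  have "\<Phi> x a = 0" if "a \<notin> T" for a
  proof -
    have "\<Phi> v a = 0" if "v \<in> A" for v
      using that A assms coord_unit \<open>a \<notin> T\<close> by fastforce
    then show ?thesis unfolding x by (simp add: coord_lincomb A AV)
  qed
  moreover have "x \<in> carrier V"
    unfolding x using AV by (intro lincomb_closed) auto
  ultimately show "x \<in> {x \<in> carrier V. \<forall>a. a \<notin> T \<longrightarrow> \<Phi> x a = 0}" by auto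
next
  fix x assume "x \<in> {x \<in> carrier V. \<forall>a. a \<notin> T \<longrightarrow> \<Phi> x a = 0}"
  then have x: "x \<in> carrier V" "\<And>a. a \<notin> T \<Longrightarrow> \<Phi> x a = 0" by auto
  \<comment> \<open>Coefficients in \<open>lincomb\<close> are indexed by vectors, so the index of a
    unit is recovered by inverting \<open>e\<close>.\<close>
  define c where "c = (\<lambda>v. \<Phi> x (the_inv_into S e v))"
  have T: "finite (e ` T)" "e ` T \<subseteq> carrier V" "finite T"
    using assms finite_index finite_subset unit_mem by auto
  have "x = lincomb c (e ` T)"
  proof (rule coord_eqI)
    show "lincomb c (e ` T) \<in> carrier V"
      using T by (intro lincomb_closed) auto
    fix a
    have "\<Phi> (lincomb c (e ` T)) a = (\<Sum>b\<in>T. c (e b) * \<Phi> (e b) a)"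
      using T inj_on_subset[OF unit_inj assms]
      by (simp add: coord_lincomb sum.reindex)
    also have "\<dots> = (\<Sum>b\<in>T. if a = b then \<Phi> x b else 0)"
      using assms unit_inj by (intro sum.cong) (auto simp: c_def coord_unit the_inv_into_f_f subset_iff)
    also have "\<dots> = \<Phi> x a"
      using x(2)[of a] T by simp
    finally show "\<Phi> x a = \<Phi> (lincomb c (e ` T)) a" by simp
  qed (rule x(1))
  then show "x \<in> span (e ` T)"
    unfolding span_def using T by auto
qed

text \<open>Taking coordinate \<open>a\<close> of a vanishing combination isolates the coefficient
  of \<open>e a\<close>.\<close>

lemma lin_indpt_units: "lin_indpt (e ` S)"
proof
  assume "lin_dep (e ` S)"
  then obtain A c v where A: "finite A" "A \<subseteq> e ` S" "lincomb c A = \<zero>" "v \<in> A" "c v \<noteq> 0"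
    unfolding lin_dep_def by auto
  then obtain a where a: "a \<in> S" "v = e a" by auto
  have AV: "A \<subseteq> carrier V" using A unit_mem by auto
  have "0 = \<Phi> (lincomb c A) a"
    by (simp add: A coord_zero)
  also have "\<dots> = (\<Sum>w\<in>A. c w * \<Phi> w a)"
    by (rule coord_lincomb[OF A(1) AV])
  also have "\<dots> = (\<Sum>w\<in>A. if v = w then c v else 0)"
  proof (rule sum.cong)
    fix w assume "w \<in> A"
    then obtain b where "b \<in> S" "w = e b" using A by auto
    then show "c w * \<Phi> w a = (if v = w then c v else 0)"
      using a unit_inj by (auto simp: coord_unit inj_on_def)
  qed simp
  also have "\<dots> = c v" using A by simp
  finally show False using A by simp
qed

end

lemma dim_eq_card: "dim = card S"
proof -
  have "\<exists>x\<in>carrier V. \<forall>b. \<Phi> x b = (if b = a then 1 else 0)" if "a \<in> S" for a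
    using that coord_surj[of "\<lambda>b. if b = a then 1 else 0"] by metis
  then obtain e where e: "\<And>a. a \<in> S \<Longrightarrow> e a \<in> carrier V"
      "\<And>a b. a \<in> S \<Longrightarrow> \<Phi> (e a) b = (if b = a then 1 else 0)"
    by metis
  have "gen_set (e ` S)"
    using coord_outside by (subst span_units[OF e]) auto
  then have "basis (e ` S)"
    using lin_indpt_units[OF e] e(1) by (auto simp: basis_def)
  then have "dim = card (e ` S)"
    using finite_index by (intro dim_basis) auto
  then show ?thesis
    using unit_inj[OF e] by (simp add: card_image)
qed

text \<open>Supplies differences through the coordinates; they serve as witnesses when membership in
  a coset is shown.\<close>

lemma coord_diff_surj:
  assumes "x \<in> carrier V" "y \<in> carrier V"
  obtains z where "z \<in> carrier V" "\<And>a. \<Phi> z a = \<Phi> x a - \<Phi> y a"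
proof -
  have "\<Phi> x a - \<Phi> y a = 0" if "a \<notin> S" for a
    using that assms by (simp add: coord_outside)
  then obtain z where "z \<in> carrier V" "\<Phi> z = (\<lambda>a. \<Phi> x a - \<Phi> y a)"
    using coord_surj[of "\<lambda>a. \<Phi> x a - \<Phi> y a"] by auto
  then show thesis using that by simp
qed

section \<open>Bigraded pieces of the associated graded space in coordinates\<close>

context
  fixes r d :: "'a \<Rightarrow> nat" and F :: "int \<Rightarrow> 'b set" and D :: "nat \<Rightarrow> 'b set"
  assumes filtration: "\<And>p. F p = {x \<in> carrier V. \<forall>a. int (r a) > p \<longrightarrow> \<Phi> x a = 0}"
    and grading: "\<And>n. D n = {x \<in> carrier V. \<forall>a. d a \<noteq> n \<longrightarrow> \<Phi> x a = 0}"
begin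

text \<open>Adding an element of \<open>F (int p - 1)\<close> changes only coordinates of weight
  below \<open>p\<close>: for natural weights, exceeding \<open>int p - 1\<close> means being at
  least \<open>p\<close>. At \<open>p = 0\<close> the step \<open>F (-1)\<close> is zero and all
  coordinates are fixed.\<close>

lemma filtration_coset:
  assumes x: "x \<in> carrier V"
  shows "F (int p - 1) +> x = {y \<in> carrier V. \<forall>a. r a \<ge> p \<longrightarrow> \<Phi> y a = \<Phi> x a}"
proof (intro equalityI subsetI)
  fix y assume "y \<in> F (int p - 1) +> x"
  then obtain h where "h \<in> F (int p - 1)" "y = h \<oplus> x"
    by (auto simp: a_r_coset_def')
  then show "y \<in> {y \<in> carrier V. \<forall>a. r a \<ge> p \<longrightarrow> \<Phi> y a = \<Phi> x a}"
    using x by (auto simp: filtration add_mem coord_add)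
next
  fix y assume y: "y \<in> {y \<in> carrier V. \<forall>a. r a \<ge> p \<longrightarrow> \<Phi> y a = \<Phi> x a}"
  then obtain h where h: "h \<in> carrier V" "\<And>a. \<Phi> h a = \<Phi> y a - \<Phi> x a"
    using coord_diff_surj x by blast
  then have "h \<in> F (int p - 1)" using y by (auto simp: filtration)
  moreover have "y = h \<oplus> x"
    using x y h by (intro coord_eqI) (auto simp: add_mem coord_add)
  ultimately show "y \<in> F (int p - 1) +> x"
    by (auto simp: a_r_coset_def')
qed

lemma filtration_coset_zero: "F (int p - 1) +> \<zero> = F (int p - 1)"
  by (auto simp: filtration_coset zero_mem coord_zero filtration)

lemma filtration_coset_add:
  assumes "x \<in> carrier V" "y \<in> carrier V"
  shows "set_add V (F (int p - 1) +> x) (F (int p - 1) +> y) = F (int p - 1) +> (x \<oplus> y)"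
proof (intro equalityI subsetI)
  fix z assume "z \<in> set_add V (F (int p - 1) +> x) (F (int p - 1) +> y)"
  then show "z \<in> F (int p - 1) +> (x \<oplus> y)"
    using assms by (auto simp: set_add_def' filtration_coset add_mem coord_add)
next
  fix z assume "z \<in> F (int p - 1) +> (x \<oplus> y)"
  then have z: "z \<in> carrier V" "\<And>a. r a \<ge> p \<Longrightarrow> \<Phi> z a = \<Phi> x a + \<Phi> y a"
    using assms by (auto simp: filtration_coset add_mem coord_add)
  \<comment> \<open>The first summand is kept equal to \<open>x\<close>; the whole deviation of
    \<open>z\<close> goes into the second, which stays in the coset of \<open>y\<close>.\<close>
  obtain w where w: "w \<in> carrier V" "\<And>a. \<Phi> w a = \<Phi> z a - \<Phi> x a"
    using coord_diff_surj z(1) assms(1) by blast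
  have "z = x \<oplus> w"
    using z w assms by (intro coord_eqI) (auto simp: add_mem coord_add)
  moreover have "x \<in> F (int p - 1) +> x" "w \<in> F (int p - 1) +> y"
    using z w assms by (auto simp: filtration_coset)
  ultimately show "z \<in> set_add V (F (int p - 1) +> x) (F (int p - 1) +> y)"
    by (auto simp: set_add_def')
qed

text \<open>Scalar multiplication in \<open>gr_piece\<close> is a union over representatives. All
  members of the union are the same coset, because the coordinates of weight at least
  \<open>p\<close> do not depend on the representative.\<close>

lemma filtration_coset_smult:
  assumes x: "x \<in> carrier V"
  shows "(\<Union>y \<in> F (int p - 1) +> x. F (int p - 1) +> (c \<odot> y)) = F (int p - 1) +> (c \<odot> x)"
proof -
  have "F (int p - 1) +> (c \<odot> y) = F (int p - 1) +> (c \<odot> x)" if "y \<in> F (int p - 1) +> x" for y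
    using that x by (auto simp: filtration_coset smult_mem coord_smult)
  moreover have "x \<in> F (int p - 1) +> x"
    using x by (simp add: filtration_coset)
  ultimately show ?thesis by blast
qed

text \<open>The class of \<open>x\<close> placed in filtration degree \<open>p\<close>. The other
  components are written as cosets of zero, so that the coset rules apply uniformly in all
  degrees.\<close>

definition homogeneous_class :: "nat \<Rightarrow> 'b \<Rightarrow> nat \<Rightarrow> 'b set" where
  "homogeneous_class p x = (\<lambda>q. F (int q - 1) +> (if q = p then x else \<zero>))"

lemma bigraded_part_eq:
  "bigraded_part V F D p n = homogeneous_class p ` (F (int p) \<inter> D n)"
proof (intro equalityI subsetI)
  fix g assume "g \<in> bigraded_part V F D p n"
  then obtain x where x: "x \<in> F (int p) \<inter> D n" "g p = F (int p - 1) +> x"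
    and "\<And>q. q \<noteq> p \<Longrightarrow> g q = F (int q - 1)"
    by (auto simp: bigraded_part_def gr_piece_def)
  then have "g = homogeneous_class p x"
    by (auto simp: fun_eq_iff homogeneous_class_def filtration_coset_zero)
  then show "g \<in> homogeneous_class p ` (F (int p) \<inter> D n)"
    using x by auto
next
  fix g assume "g \<in> homogeneous_class p ` (F (int p) \<inter> D n)"
  then obtain x where x: "x \<in> F (int p) \<inter> D n" and g: "g = homogeneous_class p x" by auto
  have "\<zero> \<in> F q" for q
    by (simp add: filtration zero_mem coord_zero)
  then have "g q \<in> carrier (gr_piece V F q)" for q
    using x by (auto simp: g homogeneous_class_def gr_piece_def)
  moreover have "{q. g q \<noteq> F (int q - 1)} \<subseteq> {p}"
    by (auto simp: g homogeneous_class_def filtration_coset_zero)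
  then have "finite {q. g q \<noteq> F (int q - 1)}"
    by (rule finite_subset) simp
  ultimately show "g \<in> bigraded_part V F D p n"
    using x by (auto simp: bigraded_part_def assoc_graded_def gr_piece_def g
        homogeneous_class_def filtration_coset_zero)
qed

text \<open>Modulo \<open>F (int p - 1)\<close> only coordinates of weight at least \<open>p\<close>
  count. Among these, membership in \<open>F (int p)\<close> kills weights above \<open>p\<close>
  and membership in \<open>D n\<close> kills degrees other than \<open>n\<close>, which leaves
  exactly the indices of bidegree \<open>(p, n)\<close>.\<close>

lemma homogeneous_class_eq_iff:
  assumes "x \<in> F (int p) \<inter> D n" "y \<in> F (int p) \<inter> D n"
  shows "homogeneous_class p x = homogeneous_class p y \<longleftrightarrow>
    (\<forall>a \<in> {a \<in> S. r a = p \<and> d a = n}. \<Phi> x a = \<Phi> y a)" (is "?l = ?r")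
proof
  have xy: "x \<in> carrier V" "y \<in> carrier V" using assms by (auto simp: filtration)
  { assume ?l
    then have "homogeneous_class p x p = homogeneous_class p y p" by simp
    then have "F (int p - 1) +> x = F (int p - 1) +> y"
      by (simp add: homogeneous_class_def)
    moreover have "x \<in> F (int p - 1) +> x"
      using xy by (simp add: filtration_coset)
    ultimately show ?r
      using xy by (auto simp: filtration_coset)
  }
  assume ?r
  have "\<Phi> x a = \<Phi> y a" if "r a \<ge> p" for a
  proof (cases "a \<in> S \<and> r a = p \<and> d a = n")
    case False
    then consider "a \<notin> S" | "r a > p" | "d a \<noteq> n" using \<open>r a \<ge> p\<close> by linarith
    then have "\<Phi> z a = 0" if "z \<in> F (int p) \<inter> D n" for z
      using that by cases (auto simp: filtration grading coord_outside)
    then show ?thesis using assms by metis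
  qed (use \<open>?r\<close> in simp)
  then show ?l
    using xy by (auto simp: homogeneous_class_def filtration_coset fun_eq_iff)
qed

text \<open>Coordinates of weight at least \<open>p\<close> are constant on the coset, hence
  readable from an arbitrarily chosen representative.\<close>

lemma coord_representative:
  assumes x: "x \<in> carrier V" and "p \<le> r a"
  shows "\<Phi> (SOME y. y \<in> homogeneous_class p x p) a = \<Phi> x a"
proof -
  have "(SOME y. y \<in> homogeneous_class p x p) \<in> homogeneous_class p x p"
    using x unfolding some_in_eq by (auto simp: homogeneous_class_def filtration_coset)
  then show ?thesis
    using assms by (auto simp: homogeneous_class_def filtration_coset)
qed

text \<open>All operations on the piece descend from \<open>V\<close> through
  \<open>homogeneous_class\<close>. The coordinates at indices of bidegree \<open>(p, n)\<close> are
  well defined on classes and separate them by \<open>homogeneous_class_eq_iff\<close>.\<close>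

lemma bigraded_part_coordinates:
  "finite_coordinates ((assoc_graded V F)\<lparr>carrier := bigraded_part V F D p n\<rparr>)
     {a \<in> S. r a = p \<and> d a = n}
     (\<lambda>g a. if a \<in> S \<and> r a = p \<and> d a = n then \<Phi> (SOME x. x \<in> g p) a else 0)"
    (is "finite_coordinates ?W ?S ?\<Psi>")
proof -
  let ?X = "F (int p) \<inter> D n" and ?h = "homogeneous_class p"
  have X: "x \<in> carrier V" if "x \<in> ?X" for x using that by (auto simp: filtration)
  have carr: "carrier ?W = ?h ` ?X"
    by (simp add: bigraded_part_eq)
  have zero: "\<zero>\<^bsub>?W\<^esub> = ?h \<zero>" and zeroX: "\<zero> \<in> ?X"
    by (auto simp: assoc_graded_def gr_piece_def homogeneous_class_def filtration_coset_zero
        filtration grading zero_mem coord_zero fun_eq_iff)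
  have add: "?h x \<oplus>\<^bsub>?W\<^esub> ?h y = ?h (x \<oplus> y)" and addX: "x \<oplus> y \<in> ?X"
    if "x \<in> ?X" "y \<in> ?X" for x y
  proof -
    \<comment> \<open>Needed for the components in degrees other than \<open>p\<close>, where two
      cosets of zero are added.\<close>
    have "\<zero> \<oplus> \<zero> = \<zero>"
      by (intro coord_eqI) (auto simp: add_mem zero_mem coord_add coord_zero)
    then show "?h x \<oplus>\<^bsub>?W\<^esub> ?h y = ?h (x \<oplus> y)"
      using X that by (auto simp: assoc_graded_def gr_piece_def homogeneous_class_def
          filtration_coset_add zero_mem fun_eq_iff simp del: Int_iff)
    show "x \<oplus> y \<in> ?X"
      using that by (auto simp: filtration grading add_mem coord_add)
  qed
  have smult: "c \<odot>\<^bsub>?W\<^esub> ?h x = ?h (c \<odot> x)" and smultX: "c \<odot> x \<in> ?X" if "x \<in> ?X" for c x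
  proof -
    have "c \<odot> \<zero> = \<zero>"
      by (intro coord_eqI) (auto simp: smult_mem zero_mem coord_smult coord_zero)
    then show "c \<odot>\<^bsub>?W\<^esub> ?h x = ?h (c \<odot> x)"
      using X[OF that] by (auto simp: assoc_graded_def gr_piece_def homogeneous_class_def
          filtration_coset_smult zero_mem fun_eq_iff)
    show "c \<odot> x \<in> ?X"
      using that by (auto simp: filtration grading smult_mem coord_smult)
  qed
  have \<Psi>: "?\<Psi> (?h x) a = (if a \<in> S \<and> r a = p \<and> d a = n then \<Phi> x a else 0)" if "x \<in> ?X" for x a
    using X[OF that] by (simp add: coord_representative)
  have "bij_betw ?\<Psi> (?h ` ?X) {f. \<forall>a. a \<notin> ?S \<longrightarrow> f a = 0}"
  proof (rule bij_betw_imageI)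
    show "inj_on ?\<Psi> (?h ` ?X)"
    proof (rule inj_onI, elim imageE)
      fix g g' x y assume *: "?\<Psi> g = ?\<Psi> g'" "g = ?h x" "x \<in> ?X" "g' = ?h y" "y \<in> ?X"
      have "?\<Psi> (?h x) a = ?\<Psi> (?h y) a" for a
        using fun_cong[OF *(1), of a] unfolding *(2,4) .
      then have "\<Phi> x a = \<Phi> y a" if "a \<in> ?S" for a
        using that unfolding \<Psi>[OF *(3)] \<Psi>[OF *(5)] by (metis (mono_tags) mem_Collect_eq)
      then show "g = g'"
        unfolding *(2,4) using homogeneous_class_eq_iff[OF *(3,5)] by blast
    qed
    have "f \<in> ?\<Psi> ` ?h ` ?X" if f: "\<forall>a. a \<notin> ?S \<longrightarrow> f a = 0" for f
    proof -
      obtain x where x: "x \<in> carrier V" "\<Phi> x = f"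
        using coord_surj[of f] f by auto
      \<comment> \<open>A vector supported on indices of bidegree \<open>(p, n)\<close> satisfies
        both vanishing conditions, so it is itself a representative.\<close>
      then have "x \<in> ?X" using f by (auto simp: filtration grading)
      moreover have "?\<Psi> (?h x) = f"
        using x f by (intro ext) (subst \<Psi>[OF \<open>x \<in> ?X\<close>], auto)
      ultimately show ?thesis by blast
    qed
    then show "?\<Psi> ` ?h ` ?X = {f. \<forall>a. a \<notin> ?S \<longrightarrow> f a = 0}" by auto
  qed
  then have bij: "bij_betw ?\<Psi> (carrier ?W) {f. \<forall>a. a \<notin> ?S \<longrightarrow> f a = 0}"
    unfolding carr .
  show ?thesis
  proof (rule finite_coordinates.intro[OF _ bij])
    show "finite ?S" using finite_index by simp
    show "\<zero>\<^bsub>?W\<^esub> \<in> carrier ?W" unfolding carr zero using zeroX by (rule imageI)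
    show "?\<Psi> \<zero>\<^bsub>?W\<^esub> a = 0" for a unfolding zero \<Psi>[OF zeroX] by (simp add: coord_zero)
  next
    fix g g' c a assume "g \<in> carrier ?W" "g' \<in> carrier ?W"
    then obtain x y where x: "x \<in> ?X" "g = ?h x" and y: "y \<in> ?X" "g' = ?h y"
      unfolding carr by blast
    show "g \<oplus>\<^bsub>?W\<^esub> g' \<in> carrier ?W"
      unfolding x(2) y(2) add[OF x(1) y(1)] carr using addX[OF x(1) y(1)] by (rule imageI)
    show "?\<Psi> (g \<oplus>\<^bsub>?W\<^esub> g') a = ?\<Psi> g a + ?\<Psi> g' a"
      unfolding x(2) y(2) add[OF x(1) y(1)] \<Psi>[OF x(1)] \<Psi>[OF y(1)] \<Psi>[OF addX[OF x(1) y(1)]]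
      using X x y by (simp add: coord_add)
  next
    fix g c a assume "g \<in> carrier ?W"
    then obtain x where x: "x \<in> ?X" "g = ?h x"
      unfolding carr by blast
    show "c \<odot>\<^bsub>?W\<^esub> g \<in> carrier ?W"
      unfolding x(2) smult[OF x(1)] carr using smultX[OF x(1)] by (rule imageI)
    show "?\<Psi> (c \<odot>\<^bsub>?W\<^esub> g) a = c * ?\<Psi> g a"
      unfolding x(2) smult[OF x(1)] \<Psi>[OF x(1)] \<Psi>[OF smultX[OF x(1)]]
      using X x by (simp add: coord_smult)
  qed
qed

lemma dim_bigraded_part:
  "vectorspace.dim class_ring ((assoc_graded V F)\<lparr>carrier := bigraded_part V F D p n\<rparr>) =
     card {a \<in> S. r a = p \<and> d a = n}"
  by (rule finite_coordinates.dim_eq_card[OF bigraded_part_coordinates])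

end

end

section \<open>Coordinates on the squarefree edge algebra\<close>

text \<open>The exponent vector of the squarefree monomial z_A. Over an infinite \<open>A\<close>
  the sum has the default value 0, which explains the finiteness assumptions below.\<close>

definition exponent :: "'e set \<Rightarrow> 'e \<Rightarrow>\<^sub>0 nat" where
  "exponent A = (\<Sum>e\<in>A. Poly_Mapping.single e 1)"

lemma lookup_exponent:
  "finite A \<Longrightarrow> Poly_Mapping.lookup (exponent A) e = (if e \<in> A then 1 else 0)"
  by (simp add: exponent_def lookup_sum lookup_single when_def)

lemma keys_exponent: "finite A \<Longrightarrow> Poly_Mapping.keys (exponent A) = A"
  by (auto simp: in_keys_iff lookup_exponent split: if_splits)

lemma exponent_eq_iff: "\<lbrakk>finite A; finite B\<rbrakk> \<Longrightarrow> exponent A = exponent B \<longleftrightarrow> A = B"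
  by (metis keys_exponent)

text \<open>A squarefree monomial is determined by its support. The equation
  \<open>exponent (keys m) = m\<close> thus serves as the test for squarefreeness of
  \<open>m\<close>.\<close>

lemma exponent_keys:
  assumes "\<And>e. Poly_Mapping.lookup m e \<le> 1"
  shows "exponent (Poly_Mapping.keys m) = m"
proof (rule poly_mapping_eqI)
  fix e
  show "Poly_Mapping.lookup (exponent (Poly_Mapping.keys m)) e = Poly_Mapping.lookup m e"
    using assms[of e]
    by (cases "Poly_Mapping.lookup m e = 0") (auto simp: lookup_exponent in_keys_iff)
qed

text \<open>Addition of exponents is multiplication of monomials: a divisor of z_A is squarefree
  with support inside \<open>A\<close>.\<close>

lemma exponent_summand:
  assumes "finite A" "exponent A = m + m'"
  shows "Poly_Mapping.keys m \<subseteq> A" "exponent (Poly_Mapping.keys m) = m"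
proof -
  have *: "Poly_Mapping.lookup m e \<le> (if e \<in> A then 1 else 0)" for e
    using lookup_exponent[OF assms(1), of e] by (simp add: assms(2) lookup_add split: if_splits)
  show "exponent (Poly_Mapping.keys m) = m"
    by (intro exponent_keys order_trans[OF *]) simp
  show "Poly_Mapping.keys m \<subseteq> A"
  proof
    fix e assume "e \<in> Poly_Mapping.keys m"
    then show "e \<in> A"
      using *[of e] by (simp add: in_keys_iff split: if_splits)
  qed
qed

lemma prod_var_poly:
  "finite A \<Longrightarrow> (\<Prod>e\<in>A. var_poly e) = (Poly_Mapping.single (exponent A) 1 :: ('e, 'k::field) mpoly)"
  by (induction A rule: finite_induct) (simp_all add: exponent_def var_poly_def mult_single)

lemma var_poly_square:
  "var_poly e ^ 2 = (Poly_Mapping.single (Poly_Mapping.single e 2) 1 :: ('e, 'k::field) mpoly)"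
  unfolding var_poly_def power2_eq_square mult_single
  by (simp add: numeral_2_eq_2 flip: single_add)

lemma sum_monomials:
  fixes p :: "'a \<Rightarrow>\<^sub>0 'b::comm_monoid_add"
  shows "(\<Sum>m\<in>Poly_Mapping.keys p. Poly_Mapping.single m (Poly_Mapping.lookup p m)) = p"
  by (rule poly_mapping_eqI) (auto simp: lookup_sum lookup_single when_def in_keys_iff)

lemma keys_mult_subset:
  fixes p q :: "('e, 'k::field) mpoly"
  assumes "\<And>m. m \<in> Poly_Mapping.keys p \<Longrightarrow> Poly_Mapping.keys m \<subseteq> E"
    and "\<And>m. m \<in> Poly_Mapping.keys q \<Longrightarrow> Poly_Mapping.keys m \<subseteq> E"
    and "m \<in> Poly_Mapping.keys (p * q)"
  shows "Poly_Mapping.keys m \<subseteq> E"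
proof -
  obtain a b where "a \<in> Poly_Mapping.keys p" "b \<in> Poly_Mapping.keys q" "m = a + b"
    using keys_mult[of p q] assms(3) by blast
  then show ?thesis
    using assms(1,2) keys_add[of a b] by blast
qed

section \<open>The polynomial ring and the ideal generated by the squares\<close>

lemma poly_ring_cring: "cring (poly_ring E :: ('e, 'k::field) mpoly ring)"
proof (rule cringI)
  let ?P = "poly_ring E :: ('e, 'k) mpoly ring"
  show "abelian_group ?P"
  proof (rule abelian_groupI)
    fix x assume "x \<in> carrier ?P"
    then show "\<exists>y\<in>carrier ?P. y \<oplus>\<^bsub>?P\<^esub> x = \<zero>\<^bsub>?P\<^esub>"
      by (intro bexI[of _ "- x"]) (auto simp: poly_ring_def)
  next
    fix x y assume "x \<in> carrier ?P" "y \<in> carrier ?P"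
    then show "x \<oplus>\<^bsub>?P\<^esub> y \<in> carrier ?P"
      using keys_add[of x y] by (auto simp: poly_ring_def)
  qed (auto simp: poly_ring_def algebra_simps)
  show "comm_monoid ?P"
  proof (rule comm_monoidI)
    fix x y assume "x \<in> carrier ?P" "y \<in> carrier ?P"
    then show "x \<otimes>\<^bsub>?P\<^esub> y \<in> carrier ?P"
      using keys_mult_subset[of x E y] by (simp add: poly_ring_def)
  qed (simp_all add: poly_ring_def algebra_simps)
qed (auto simp: poly_ring_def algebra_simps)

lemma minus_poly_ring:
  fixes p q :: "('e, 'k::field) mpoly"
  assumes "p \<in> carrier (poly_ring E)" "q \<in> carrier (poly_ring E)"
  shows "p - q \<in> carrier (poly_ring E)"
  using assms keys_diff[of p q] by (auto simp: poly_ring_def)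

text \<open>Absorption under multiplication is the point: if a squarefree monomial occurred in
  \<open>x * p\<close>, its factor coming from \<open>p\<close> would be a squarefree monomial
  occurring in \<open>p\<close>, by \<open>exponent_summand\<close>.\<close>

lemma non_squarefree_ideal:
  assumes "finite E"
  shows "ideal {p \<in> carrier (poly_ring E). \<forall>A\<subseteq>E. Poly_Mapping.lookup p (exponent A) = 0}
    (poly_ring E :: ('e, 'k::field) mpoly ring)" (is "ideal ?J ?P")
proof -
  interpret P: cring ?P by (rule poly_ring_cring)
  have mult: "x * p \<in> ?J" if p: "p \<in> ?J" and x: "x \<in> carrier ?P" for x p
  proof -
    have "x * p \<in> carrier ?P"
      using P.m_closed[of x p] p x by (simp add: poly_ring_def)
    moreover have "Poly_Mapping.lookup (x * p) (exponent A) = 0" if "A \<subseteq> E" for A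
    proof (rule ccontr)
      assume "Poly_Mapping.lookup (x * p) (exponent A) \<noteq> 0"
      then have "exponent A \<in> Poly_Mapping.keys (x * p)" by (simp add: in_keys_iff)
      then obtain a b where "exponent A = a + b" and b: "b \<in> Poly_Mapping.keys p"
        using keys_mult[of x p] by blast
      then have "exponent A = b + a" by (simp add: add.commute)
      then have "Poly_Mapping.keys b \<subseteq> A" "exponent (Poly_Mapping.keys b) = b"
        using exponent_summand[of A b a] finite_subset[OF that assms] by auto
      moreover from this have "Poly_Mapping.lookup p (exponent (Poly_Mapping.keys b)) = 0"
        using p that by blast
      ultimately show False using b by (simp add: in_keys_iff)
    qed
    ultimately show ?thesis by blast
  qed
  show ?thesis
  proof (rule idealI)
    show "ring ?P" ..
    show "subgroup ?J (add_monoid ?P)"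
    proof (rule P.add.subgroupI)
      have "0 \<in> ?J" using P.zero_closed by (simp add: poly_ring_def)
      then show "?J \<noteq> {}" by blast
    next
      fix p assume p: "p \<in> ?J"
      then have "- p \<in> carrier ?P" "p \<in> carrier ?P" by (auto simp: poly_ring_def)
      moreover from this have "\<ominus>\<^bsub>?P\<^esub> p = - p"
        by (intro P.minus_equality) (auto simp: poly_ring_def)
      ultimately show "\<ominus>\<^bsub>?P\<^esub> p \<in> ?J" using p by simp
    next
      fix p q assume pq: "p \<in> ?J" "q \<in> ?J"
      then have "p \<oplus>\<^bsub>?P\<^esub> q \<in> carrier ?P" by (intro P.a_closed) auto
      then show "p \<oplus>\<^bsub>?P\<^esub> q \<in> ?J"
        using pq by (simp add: poly_ring_def lookup_add)
    qed auto
    fix p x assume "p \<in> ?J" "x \<in> carrier ?P"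
    from mult[OF this] show "x \<otimes>\<^bsub>?P\<^esub> p \<in> ?J" "p \<otimes>\<^bsub>?P\<^esub> x \<in> ?J"
      by (simp_all add: poly_ring_def mult.commute)
  qed
qed

lemma var_poly_squares: "{var_poly e ^ 2 |e. e \<in> E} \<subseteq> carrier (poly_ring E :: ('e, 'k::field) mpoly ring)"
  by (auto simp: poly_ring_def var_poly_square)

lemma square_ideal: "ideal (square_ideal E) (poly_ring E :: ('e, 'k::field) mpoly ring)"
proof -
  interpret P: cring "poly_ring E :: ('e, 'k) mpoly ring" by (rule poly_ring_cring)
  show ?thesis
    unfolding square_ideal_def by (rule P.genideal_ideal[OF var_poly_squares])
qed

text \<open>A monomial that fails the squarefreeness test has some exponent at least 2, and the
  corresponding square, a generator of the ideal, can be split off.\<close>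

lemma non_squarefree_monomial:
  fixes m :: "'e \<Rightarrow>\<^sub>0 nat" and c :: "'k::field"
  assumes "Poly_Mapping.keys m \<subseteq> E" "exponent (Poly_Mapping.keys m) \<noteq> m"
  shows "Poly_Mapping.single m c \<in> square_ideal E"
proof -
  let ?P = "poly_ring E :: ('e, 'k) mpoly ring"
  interpret P: cring ?P by (rule poly_ring_cring)
  interpret I: ideal "square_ideal E" ?P by (rule square_ideal)
  obtain e where e: "Poly_Mapping.lookup m e \<ge> 2"
    using assms(2) exponent_keys[of m] by (metis One_nat_def Suc_1 not_less_eq_eq)
  define m' where "m' = m - Poly_Mapping.single e 2"
  \<comment> \<open>Subtraction of exponents truncates at zero; it is exact here because the
    exponent of \<open>e\<close> is at least 2.\<close>
  have m: "m = m' + Poly_Mapping.single e 2"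
    using e by (intro poly_mapping_eqI) (auto simp: m'_def lookup_add lookup_minus lookup_single when_def)
  have "Poly_Mapping.keys m' \<subseteq> Poly_Mapping.keys m"
    by (auto simp: m in_keys_iff lookup_add)
  then have "Poly_Mapping.single m' c \<in> carrier ?P"
    using assms(1) by (auto simp: poly_ring_def)
  moreover have "e \<in> E" using e assms(1) by (auto simp: in_keys_iff)
  then have "var_poly e ^ 2 \<in> (square_ideal E :: ('e, 'k) mpoly set)"
    unfolding square_ideal_def using P.genideal_self[OF var_poly_squares] by blast
  ultimately have "Poly_Mapping.single m' c \<otimes>\<^bsub>?P\<^esub> var_poly e ^ 2 \<in> square_ideal E"
    by (rule I.I_l_closed[rotated])
  then show ?thesis
    by (simp add: poly_ring_def var_poly_square mult_single m)
qed

text \<open>The right-hand side is an ideal containing the generators, hence contains the generated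
  ideal. Conversely, each of its members is the sum of its monomials, none of them squarefree, so
  each lies in the generated ideal.\<close>

lemma square_ideal_eq:
  assumes "finite E"
  shows "(square_ideal E :: ('e, 'k::field) mpoly set) =
    {p \<in> carrier (poly_ring E). \<forall>A\<subseteq>E. Poly_Mapping.lookup p (exponent A) = 0}" (is "_ = ?J")
proof
  let ?P = "poly_ring E :: ('e, 'k) mpoly ring"
  interpret P: cring ?P by (rule poly_ring_cring)
  interpret I: ideal "square_ideal E" ?P by (rule square_ideal)
  have "Poly_Mapping.single e 2 \<noteq> exponent A" if "A \<subseteq> E" for A and e :: 'e
  proof
    assume "Poly_Mapping.single e 2 = exponent A"
    then have "Poly_Mapping.lookup (Poly_Mapping.single e 2 :: 'e \<Rightarrow>\<^sub>0 nat) e = Poly_Mapping.lookup (exponent A) e"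
      by simp
    then show False
      using finite_subset[OF that assms] by (simp add: lookup_exponent split: if_splits)
  qed
  then have "{var_poly e ^ 2 |e. e \<in> E} \<subseteq> ?J"
    using var_poly_squares[of E] by (auto simp: var_poly_square lookup_single when_def)
  then show "square_ideal E \<subseteq> ?J"
    unfolding square_ideal_def by (rule P.genideal_minimal[OF non_squarefree_ideal[OF assms]])
  show "?J \<subseteq> square_ideal E"
  proof
    fix p assume p: "p \<in> ?J"
    have monomial: "Poly_Mapping.single m (Poly_Mapping.lookup p m) \<in> square_ideal E"
      if "m \<in> Poly_Mapping.keys p" for m
    proof (rule non_squarefree_monomial)
      show "Poly_Mapping.keys m \<subseteq> E" using p that by (auto simp: poly_ring_def)
      \<comment> \<open>Otherwise \<open>m\<close> would be a squarefree monomial over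
        \<open>E\<close>, whose coefficient in \<open>p\<close> is zero.\<close>
      then show "exponent (Poly_Mapping.keys m) \<noteq> m"
        using p that by (auto simp: in_keys_iff)
    qed
    have "(\<Sum>m\<in>M. g m) \<in> square_ideal E"
      if "finite M" "\<And>m. m \<in> M \<Longrightarrow> g m \<in> square_ideal E" for M and g :: "_ \<Rightarrow> ('e, 'k) mpoly"
      using that
    proof (induction M rule: finite_induct)
      case empty
      then show ?case using I.zero_closed by (simp add: poly_ring_def)
    next
      case (insert m M)
      then show ?case using I.a_closed[of "g m" "sum g M"] by (simp add: poly_ring_def)
    qed
    from this[OF finite_keys monomial]
    have "(\<Sum>m\<in>Poly_Mapping.keys p. Poly_Mapping.single m (Poly_Mapping.lookup p m))
        \<in> square_ideal E" .
    then show "p \<in> square_ideal E" by (simp add: sum_monomials)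
  qed
qed

lemma square_ideal_coset:
  fixes p :: "('e, 'k::field) mpoly"
  assumes "finite E" and p: "p \<in> carrier (poly_ring E)"
  shows "square_ideal E +>\<^bsub>poly_ring E\<^esub> p =
    {q \<in> carrier (poly_ring E). \<forall>A\<subseteq>E. Poly_Mapping.lookup q (exponent A) = Poly_Mapping.lookup p (exponent A)}"
    (is "_ = ?C")
proof (intro equalityI subsetI)
  let ?P = "poly_ring E :: ('e, 'k) mpoly ring"
  interpret P: cring ?P by (rule poly_ring_cring)
  {
    fix q assume "q \<in> square_ideal E +>\<^bsub>?P\<^esub> p"
    then obtain h where h: "h \<in> square_ideal E" "q = h + p"
      by (auto simp: a_r_coset_def' poly_ring_def)
    then have "h \<oplus>\<^bsub>?P\<^esub> p \<in> carrier ?P"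
      using p by (intro P.a_closed) (auto simp: square_ideal_eq assms(1))
    then show "q \<in> ?C"
      using h by (auto simp: square_ideal_eq assms(1) lookup_add poly_ring_def)
  }
  fix q assume q: "q \<in> ?C"
  then have "q - p \<in> square_ideal E"
    using p by (auto simp: square_ideal_eq assms(1) lookup_minus minus_poly_ring)
  moreover have "q = (q - p) \<oplus>\<^bsub>?P\<^esub> p" by (simp add: poly_ring_def)
  ultimately show "q \<in> square_ideal E +>\<^bsub>?P\<^esub> p"
    by (auto simp: a_r_coset_def')
qed

text \<open>Squarefree coefficients are constant on cosets of the square ideal, so the choice of the
  representative is immaterial.\<close>

definition squarefree_coeff :: "'e set \<Rightarrow> ('e, 'k::field) mpoly set \<Rightarrow> 'e set \<Rightarrow> 'k" where
  "squarefree_coeff E X A = (if A \<subseteq> E then Poly_Mapping.lookup (SOME p. p \<in> X) (exponent A) else 0)"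

lemma squarefree_coeff_coset:
  fixes p :: "('e, 'k::field) mpoly"
  assumes "finite E" "p \<in> carrier (poly_ring E)"
  shows "squarefree_coeff E (square_ideal E +>\<^bsub>poly_ring E\<^esub> p) A =
    (if A \<subseteq> E then Poly_Mapping.lookup p (exponent A) else 0)"
proof -
  let ?X = "square_ideal E +>\<^bsub>poly_ring E\<^esub> p"
  have "(SOME q. q \<in> ?X) \<in> ?X"
    using assms unfolding some_in_eq by (auto simp: square_ideal_coset)
  then show ?thesis
    using assms by (auto simp: squarefree_coeff_def square_ideal_coset)
qed

text \<open>Reduces the operations of the quotient record to representatives; scalars act through
  the classes of constant polynomials.\<close>

lemma edge_algebra_simps:
  fixes G :: "('v, 'e) mgraph"
  defines "P \<equiv> poly_ring (edges G) :: ('e, 'k::field) mpoly ring"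
    and "I \<equiv> square_ideal (edges G) :: ('e, 'k) mpoly set"
    and "B \<equiv> edge_algebra G :: ('k, ('e, 'k) mpoly set) module"
  shows "carrier B = (\<lambda>p. I +>\<^bsub>P\<^esub> p) ` carrier P"
    and "\<zero>\<^bsub>B\<^esub> = I +>\<^bsub>P\<^esub> 0"
    and "\<lbrakk>p \<in> carrier P; q \<in> carrier P\<rbrakk> \<Longrightarrow> (I +>\<^bsub>P\<^esub> p) \<oplus>\<^bsub>B\<^esub> (I +>\<^bsub>P\<^esub> q) = I +>\<^bsub>P\<^esub> (p + q)"
    and "p \<in> carrier P \<Longrightarrow> c \<odot>\<^bsub>B\<^esub> (I +>\<^bsub>P\<^esub> p) = I +>\<^bsub>P\<^esub> (const_poly c * p)"
proof -
  interpret P: cring P unfolding P_def by (rule poly_ring_cring)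
  interpret I: ideal I P unfolding P_def I_def by (rule square_ideal)
  have B: "carrier B = a_rcosets\<^bsub>P\<^esub> I" "\<zero>\<^bsub>B\<^esub> = I" "add B = set_add P"
      "smult B c = rcoset_mult P I (I +>\<^bsub>P\<^esub> const_poly c)" for c
    by (simp_all add: B_def edge_algebra_def Let_def FactRing_def ring.extend_def module.fields_def
        flip: P_def I_def)
  show "carrier B = (\<lambda>p. I +>\<^bsub>P\<^esub> p) ` carrier P"
    by (auto simp: B A_RCOSETS_def' )
  show "\<zero>\<^bsub>B\<^esub> = I +>\<^bsub>P\<^esub> 0"
    by (simp add: B a_r_coset_def' P_def poly_ring_def)
  show "(I +>\<^bsub>P\<^esub> p) \<oplus>\<^bsub>B\<^esub> (I +>\<^bsub>P\<^esub> q) = I +>\<^bsub>P\<^esub> (p + q)" if "p \<in> carrier P" "q \<in> carrier P"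
    using I.a_rcos_sum[OF that] by (simp add: B P_def poly_ring_def)
  have "const_poly c \<in> carrier P" by (simp add: const_poly_def P_def poly_ring_def)
  then show "c \<odot>\<^bsub>B\<^esub> (I +>\<^bsub>P\<^esub> p) = I +>\<^bsub>P\<^esub> (const_poly c * p)" if "p \<in> carrier P"
    using I.rcoset_mult_add[OF _ that] by (simp add: B P_def poly_ring_def)
qed

lemma lookup_const_poly_mult:
  "Poly_Mapping.lookup (const_poly c * p) m = c * Poly_Mapping.lookup p m"
  unfolding const_poly_def
  by (subst mult_map_scale_conv_mult[symmetric]) (simp add: Poly_Mapping.map.rep_eq when_def)

text \<open>A coset of the square ideal is determined by its squarefree coefficients, and these can
  be prescribed freely.\<close>

lemma edge_algebra_coordinates:
  fixes G :: "('v, 'e) mgraph"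
  assumes fin: "finite (edges G)"
  shows "finite_coordinates (edge_algebra G :: ('k::field, ('e, 'k) mpoly set) module)
    (Pow (edges G)) (squarefree_coeff (edges G))"
proof -
  let ?E = "edges G"
  let ?P = "poly_ring ?E :: ('e, 'k) mpoly ring" and ?I = "square_ideal ?E :: ('e, 'k) mpoly set"
  let ?B = "edge_algebra G :: ('k, ('e, 'k) mpoly set) module"
  interpret P: cring ?P by (rule poly_ring_cring)
  have zero: "0 \<in> carrier ?P"
    by (simp add: poly_ring_def)
  have add: "p + q \<in> carrier ?P" if "p \<in> carrier ?P" "q \<in> carrier ?P" for p q
    using P.a_closed[OF that] by (simp add: poly_ring_def)
  have scale: "const_poly c * p \<in> carrier ?P" if "p \<in> carrier ?P" for p c
  proof -
    have "const_poly c \<in> carrier ?P" by (simp add: poly_ring_def const_poly_def)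
    from P.m_closed[OF this that] show ?thesis by (simp add: poly_ring_def)
  qed
  note simps = edge_algebra_simps squarefree_coeff_coset[OF fin]
  have "bij_betw (squarefree_coeff ?E) (carrier ?B) {f. \<forall>A. A \<notin> Pow ?E \<longrightarrow> f A = 0}"
  proof (rule bij_betw_imageI)
    show "inj_on (squarefree_coeff ?E) (carrier ?B)"
    proof (rule inj_onI)
      fix X Y assume XY: "X \<in> carrier ?B" "Y \<in> carrier ?B" "squarefree_coeff ?E X = squarefree_coeff ?E Y"
      then obtain p q where pq: "p \<in> carrier ?P" "q \<in> carrier ?P"
        "X = ?I +>\<^bsub>?P\<^esub> p" "Y = ?I +>\<^bsub>?P\<^esub> q"
        by (auto simp: edge_algebra_simps)
      have "Poly_Mapping.lookup p (exponent A) = Poly_Mapping.lookup q (exponent A)" if "A \<subseteq> ?E" for A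
        using fun_cong[OF XY(3), of A] that pq by (simp add: squarefree_coeff_coset[OF fin])
      then show "X = Y" using pq by (auto simp: square_ideal_coset[OF fin])
    qed
    have "f \<in> squarefree_coeff ?E ` carrier ?B" if f: "\<forall>A. A \<notin> Pow ?E \<longrightarrow> f A = 0"
      for f :: "'e set \<Rightarrow> 'k"
    proof -
      \<comment> \<open>The squarefree polynomial with prescribed coefficients; distinct sets give
        distinct exponents, so no two terms interfere.\<close>
      define p where "p = (\<Sum>A\<in>Pow ?E. Poly_Mapping.single (exponent A) (f A))"
      have lookup: "Poly_Mapping.lookup p m = (\<Sum>A\<in>Pow ?E. if exponent A = m then f A else 0)" for m
        by (simp add: p_def lookup_sum lookup_single when_def)
      have p: "p \<in> carrier ?P"
      proof -
        have "Poly_Mapping.keys m \<subseteq> ?E" if "m \<in> Poly_Mapping.keys p" for m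
        proof -
          have "\<exists>A\<in>Pow ?E. exponent A = m"
            using that by (auto simp: in_keys_iff lookup intro: sum.neutral dest: sum.not_neutral_contains_not_neutral split: if_splits)
          then show ?thesis
            using fin by (auto simp: keys_exponent finite_subset)
        qed
        then show ?thesis by (simp add: poly_ring_def)
      qed
      have "Poly_Mapping.lookup p (exponent A) = f A" if "A \<subseteq> ?E" for A
      proof -
        have "Poly_Mapping.lookup p (exponent A) = (\<Sum>A'\<in>Pow ?E. if A = A' then f A' else 0)"
          unfolding lookup using that finite_subset[OF _ fin]
          by (intro sum.cong) (auto simp: exponent_eq_iff)
        then show ?thesis using that fin by simp
      qed
      then have "squarefree_coeff ?E (?I +>\<^bsub>?P\<^esub> p) = f"
        using f p by (auto simp: squarefree_coeff_coset[OF fin] fun_eq_iff)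
      then show ?thesis
        using p by (auto simp: edge_algebra_simps)
    qed
    then show "squarefree_coeff ?E ` carrier ?B = {f. \<forall>A. A \<notin> Pow ?E \<longrightarrow> f A = 0}"
      by (auto simp: squarefree_coeff_def split: if_splits)
  qed
  then show ?thesis
    unfolding finite_coordinates_def
    using fin zero add scale
    by (auto simp: simps lookup_add lookup_const_poly_mult)
qed

text \<open>The classes of the z_A are the unit vectors for these coordinates, as
  \<open>span_units\<close> requires.\<close>

lemma edge_monomial_coordinates:
  fixes G :: "('v, 'e) mgraph"
  assumes "finite (edges G)" "A \<subseteq> edges G"
  shows "edge_monomial G A \<in> carrier (edge_algebra G :: ('k::field, ('e, 'k) mpoly set) module)"
    and "squarefree_coeff (edges G) (edge_monomial G A) A' = (if A' = A then 1 else (0 :: 'k))"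
proof -
  have fin: "finite A" using assms finite_subset by blast
  have *: "Poly_Mapping.single (exponent A) 1 \<in> carrier (poly_ring (edges G) :: ('e, 'k) mpoly ring)"
    using assms by (simp add: poly_ring_def keys_exponent fin)
  then show "edge_monomial G A \<in> carrier (edge_algebra G :: ('k, ('e, 'k) mpoly set) module)"
    by (simp add: edge_monomial_def prod_var_poly fin edge_algebra_simps)
  show "squarefree_coeff (edges G) (edge_monomial G A) A' = (if A' = A then 1 else (0 :: 'k))"
    using * assms fin finite_subset[of A' "edges G"]
    by (auto simp: edge_monomial_def prod_var_poly squarefree_coeff_coset lookup_single when_def exponent_eq_iff)
qed

section \<open>The Hilbert polynomial\<close>

lemma rank_filtration_eq:
  fixes G :: "('v, 'e) mgraph"
  assumes "finite (edges G)"
  shows "(rank_filtration G p :: ('e, 'k::field) mpoly set set) =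
    {X \<in> carrier (edge_algebra G). \<forall>A. int (graph_rank G A) > p \<longrightarrow> squarefree_coeff (edges G) X A = 0}"
proof -
  let ?T = "{A. A \<subseteq> edges G \<and> int (graph_rank G A) \<le> p}"
  have "(rank_filtration G p :: ('e, 'k) mpoly set set) =
      {X \<in> carrier (edge_algebra G). \<forall>A. A \<notin> ?T \<longrightarrow> squarefree_coeff (edges G) X A = 0}"
    unfolding rank_filtration_def setcompr_eq_image
    by (rule finite_coordinates.span_units[OF edge_algebra_coordinates[OF assms]])
      (auto simp: edge_monomial_coordinates[OF assms])
  \<comment> \<open>Sets not contained in \<open>edges G\<close> impose no condition, since
    \<open>squarefree_coeff\<close> is zero there by definition.\<close>
  also have "\<dots> = {X \<in> carrier (edge_algebra G). \<forall>A. int (graph_rank G A) > p \<longrightarrow>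
      squarefree_coeff (edges G) X A = 0}"
    by (auto simp: squarefree_coeff_def)
  finally show ?thesis .
qed

lemma degree_part_eq:
  fixes G :: "('v, 'e) mgraph"
  assumes "finite (edges G)"
  shows "(degree_part G n :: ('e, 'k::field) mpoly set set) =
    {X \<in> carrier (edge_algebra G). \<forall>A. card A \<noteq> n \<longrightarrow> squarefree_coeff (edges G) X A = 0}"
proof -
  let ?T = "{A. A \<subseteq> edges G \<and> card A = n}"
  have "(degree_part G n :: ('e, 'k) mpoly set set) =
      {X \<in> carrier (edge_algebra G). \<forall>A. A \<notin> ?T \<longrightarrow> squarefree_coeff (edges G) X A = 0}"
    unfolding degree_part_def setcompr_eq_image
    by (rule finite_coordinates.span_units[OF edge_algebra_coordinates[OF assms]])
      (auto simp: edge_monomial_coordinates[OF assms])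
  also have "\<dots> = {X \<in> carrier (edge_algebra G). \<forall>A. card A \<noteq> n \<longrightarrow>
      squarefree_coeff (edges G) X A = 0}"
    by (auto simp: squarefree_coeff_def)
  finally show ?thesis .
qed

text \<open>With rank and cardinality as the weights, each bigraded dimension counts the edge sets
  of that rank and size; summing over all bidegrees then counts every edge set once.\<close>

lemma hilbert_poly_eq_sum:
  fixes G :: "('v, 'e) mgraph"
  assumes "finite (edges G)"
  shows "hilbert_poly TYPE('k::field) G = (\<Sum>A\<in>Pow (edges G). var_u ^ graph_rank G A * var_s ^ card A)"
proof -
  let ?B = "edge_algebra G :: ('k, ('e, 'k) mpoly set) module"
  let ?S = "\<lambda>p n. {A \<in> Pow (edges G). graph_rank G A = p \<and> card A = n}"
  let ?I = "(\<lambda>A. (graph_rank G A, card A)) ` Pow (edges G)"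
  have dim: "vectorspace.dim class_ring ((assoc_graded ?B (rank_filtration G))
      \<lparr>carrier := bigraded_part ?B (rank_filtration G) (degree_part G) p n\<rparr>) = card (?S p n)" for p n
    by (rule finite_coordinates.dim_bigraded_part[OF edge_algebra_coordinates[OF assms]
          rank_filtration_eq[OF assms] degree_part_eq[OF assms]])
  have "hilbert_poly TYPE('k) G =
      Sum_any (\<lambda>(p, n). of_nat (card (?S p n)) * var_u ^ p * var_s ^ n)"
    by (simp add: hilbert_poly_def Let_def dim)
  \<comment> \<open>\<open>Sum_any\<close> ranges over all pairs; a pair that no edge set attains
    has coefficient zero.\<close>
  also have "\<dots> = (\<Sum>(p, n)\<in>?I. of_nat (card (?S p n)) * var_u ^ p * var_s ^ n)"
  proof (rule Sum_any.expand_superset)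
    show "finite ?I" using assms by simp
    show "{x. (case x of (p, n) \<Rightarrow> of_nat (card (?S p n)) * var_u ^ p * var_s ^ n) \<noteq> 0} \<subseteq> ?I"
    proof
      fix x assume x: "x \<in> {x. (case x of (p, n) \<Rightarrow> of_nat (card (?S p n)) * var_u ^ p * var_s ^ n) \<noteq> 0}"
      obtain p n where pn: "x = (p, n)" by (cases x)
      have "?S p n \<noteq> {}"
      proof
        assume empty: "?S p n = {}"
        show False
          using x unfolding pn mem_Collect_eq prod.case empty by simp
      qed
      then show "x \<in> ?I" unfolding pn by auto
    qed
  qed
  also have "\<dots> = (\<Sum>x\<in>?I. \<Sum>A\<in>{A \<in> Pow (edges G). (graph_rank G A, card A) = x}.
      var_u ^ graph_rank G A * var_s ^ card A)"
  proof (rule sum.cong)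
    fix x assume "x \<in> ?I"
    obtain p n where x: "x = (p, n)" by (cases x)
    have "(\<Sum>A\<in>?S p n. var_u ^ graph_rank G A * var_s ^ card A) = (\<Sum>A\<in>?S p n. var_u ^ p * var_s ^ n)"
      by (rule sum.cong) auto
    then show "(case x of (p, n) \<Rightarrow> of_nat (card (?S p n)) * var_u ^ p * var_s ^ n) =
        (\<Sum>A\<in>{A \<in> Pow (edges G). (graph_rank G A, card A) = x}. var_u ^ graph_rank G A * var_s ^ card A)"
      by (simp add: x mult.assoc)
  qed simp
  also have "\<dots> = (\<Sum>A\<in>Pow (edges G). var_u ^ graph_rank G A * var_s ^ card A)"
    using assms by (intro sum.image_gen[symmetric]) simp
  finally show ?thesis .
qed

section \<open>The subset expansion of the Negami polynomial\<close>

text \<open>Maps with the same fibres have images in bijection. This lets components be counted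
  through any convenient labelling of the vertices.\<close>

lemma card_image_eq_if_same_kernel:
  assumes "\<And>x y. \<lbrakk>x \<in> A; y \<in> A\<rbrakk> \<Longrightarrow> f x = f y \<longleftrightarrow> g x = g y"
  shows "card (f ` A) = card (g ` A)"
proof -
  have "bij_betw (\<lambda>z. g (inv_into A f z)) (f ` A) (g ` A)"
  proof (rule bij_betw_imageI)
    have inv: "inv_into A f (f x) \<in> A" "g (inv_into A f (f x)) = g x" if "x \<in> A" for x
      using that assms[of "inv_into A f (f x)" x] by (auto simp: inv_into_into f_inv_into_f)
    then show "inj_on (\<lambda>z. g (inv_into A f z)) (f ` A)"
      using assms by (auto simp: inj_on_def)
    show "(\<lambda>z. g (inv_into A f z)) ` f ` A = g ` A"
      using inv by (auto simp: image_image)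
  qed
  then show ?thesis by (rule bij_betw_same_card)
qed

section \<open>Connected components under deletion and contraction\<close>

abbreviation adjacency :: "('v, 'e) mgraph \<Rightarrow> 'e set \<Rightarrow> ('v \<times> 'v) set" where
  "adjacency G A \<equiv> {(u, v). \<exists>e\<in>A. ends G e = {u, v}}"

lemma sym_adjacency_closure: "sym ((adjacency G A)\<^sup>*)"
  by (intro sym_rtrancl symI) (auto simp: insert_commute)

lemma equiv_connected_rel: "equiv (verts G) (connected_rel G A)"
proof (rule equivI)
  show "connected_rel G A \<subseteq> verts G \<times> verts G"
    by (auto simp: connected_rel_def)
  show "refl_on (verts G) (connected_rel G A)"
    by (auto simp: refl_on_def connected_rel_def)
  show "sym (connected_rel G A)"
    using sym_adjacency_closure[of A G] by (auto simp: sym_def connected_rel_def)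
  show "trans (connected_rel G A)"
    by (auto simp: trans_def connected_rel_def intro: rtrancl_trans)
qed

lemma num_components_eq_card_image:
  assumes "\<And>u v. \<lbrakk>u \<in> verts G; v \<in> verts G\<rbrakk> \<Longrightarrow> (u, v) \<in> connected_rel G A \<longleftrightarrow> c u = c v"
  shows "num_components G A = card (c ` verts G)"
proof -
  have "verts G // connected_rel G A = (\<lambda>v. connected_rel G A `` {v}) ` verts G"
    by (auto simp: quotient_def)
  moreover have "card ((\<lambda>v. connected_rel G A `` {v}) ` verts G) = card (c ` verts G)"
    by (rule card_image_eq_if_same_kernel)
      (simp add: assms eq_equiv_class_iff[OF equiv_connected_rel])
  ultimately show ?thesis by (simp add: num_components_def)
qed

text \<open>\<open>c\<close> is constant along edges of \<open>A\<close> and joins each vertex to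
  its value, so two vertices are connected exactly when their values agree.\<close>

lemma num_components_eq_card_representatives:
  assumes invariant: "\<And>e u v. \<lbrakk>e \<in> A; ends G e = {u, v}\<rbrakk> \<Longrightarrow> c u = c v"
    and connected: "\<And>u. u \<in> verts G \<Longrightarrow> (u, c u) \<in> (adjacency G A)\<^sup>*"
  shows "num_components G A = card (c ` verts G)"
proof (rule num_components_eq_card_image)
  fix u v assume uv: "u \<in> verts G" "v \<in> verts G"
  have "c u = c v" if "(u, v) \<in> (adjacency G A)\<^sup>*"
    using that
  proof (induction rule: rtrancl_induct)
    case (step v w)
    then obtain e where "e \<in> A" "ends G e = {v, w}" by auto
    then have "c v = c w" by (rule invariant)
    then show ?case using step.IH by simp
  qed simp
  moreover have "(u, v) \<in> (adjacency G A)\<^sup>*" if "c u = c v"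
  proof (rule rtrancl_trans)
    show "(u, c v) \<in> (adjacency G A)\<^sup>*"
      using connected[OF uv(1)] unfolding that .
    show "(c v, v) \<in> (adjacency G A)\<^sup>*"
      by (rule symD[OF sym_adjacency_closure connected[OF uv(2)]])
  qed
  ultimately show "(u, v) \<in> connected_rel G A \<longleftrightarrow> c u = c v"
    using uv by (auto simp: connected_rel_def)
qed

lemma num_components_empty: "num_components G {} = card (verts G)"
  using num_components_eq_card_representatives[of "{}" G id] by simp

lemma num_components_delete: "num_components (delete_edge G e) A = num_components G A"
  by (simp add: num_components_def connected_rel_def delete_edge_def)

text \<open>The merging map sends paths using \<open>A\<close> and \<open>e\<close> to paths in the
  contraction. Paths there lift back, since every vertex is joined to its merged image by at most
  the edge \<open>e\<close>. Both graphs therefore have the same connectedness relation up to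
  merging.\<close>

lemma num_components_contract:
  assumes G: "finite_mgraph G" "e \<in> edges G" "A \<subseteq> edges G"
  shows "num_components (contract_edge G e) A = num_components G (insert e A)"
proof -
  let ?H = "contract_edge G e" and ?m = "merge_ends G e"
  let ?R = "(adjacency G (insert e A))\<^sup>*"
  obtain p q where pq: "ends G e = {p, q}" using G by (auto simp: finite_mgraph_def)
  have sym: "(u, v) \<in> ?R \<Longrightarrow> (v, u) \<in> ?R" for u v
    using sym_adjacency_closure[of "insert e A" G] by (auto simp: sym_def)
  have H: "verts ?H = ?m ` verts G" "\<And>f. ends ?H f = ?m ` ends G f"
    by (simp_all add: contract_edge_def)
  have collapse: "(w, ?m w) \<in> ?R" for w
  proof (cases "w \<in> ends G e")
    case True
    then have "?m w \<in> {p, q}" "w \<in> {p, q}"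
      using someI[of "\<lambda>w. w \<in> ends G e" p] pq by (simp_all add: merge_ends_def)
    then have "w = ?m w \<or> ends G e = {w, ?m w}" using pq by auto
    then show ?thesis by auto
  qed (simp add: merge_ends_def)
  have push: "(?m u, ?m v) \<in> (adjacency ?H A)\<^sup>*" if "(u, v) \<in> ?R" for u v
    using that
  proof (induction rule: rtrancl_induct)
    case (step v w)
    then obtain f where f: "f \<in> insert e A" "ends G f = {v, w}" by auto
    show ?case
    proof (cases "f = e")
      case True
      \<comment> \<open>A step along \<open>e\<close> becomes stationary after merging.\<close>
      then have "?m v = ?m w" using f by (simp add: merge_ends_def)
      then show ?thesis using step by simp
    next
      case False
      then have "(?m v, ?m w) \<in> adjacency ?H A" using f by (auto simp: H)
      then show ?thesis using step.IH by (rule rtrancl_into_rtrancl[rotated])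
    qed
  qed simp
  have pull: "(a, b) \<in> ?R" if "(a, b) \<in> (adjacency ?H A)\<^sup>*" for a b
    using that
  proof (induction rule: rtrancl_induct)
    case (step b c)
    then obtain f where f: "f \<in> A" "?m ` ends G f = {b, c}" by (auto simp: H)
    then have "f \<in> edges G" using G by blast
    then obtain u v where uv: "ends G f = {u, v}" using G by (auto simp: finite_mgraph_def)
    then have "(u, v) \<in> ?R" using f by auto
    \<comment> \<open>The lifted edge joins \<open>u\<close> and \<open>v\<close>; moving from
      either vertex to its merged image costs at most a step along \<open>e\<close>.\<close>
    then have "(?m u, ?m v) \<in> ?R"
      using collapse sym by (meson rtrancl_trans)
    moreover have "{b, c} = {?m u, ?m v}" using f uv by simp
    ultimately have "(b, c) \<in> ?R" using sym by (auto simp: doubleton_eq_iff)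
    then show ?case using step.IH by (meson rtrancl_trans)
  qed simp
  have "(u, v) \<in> ?R" if "(?m u, ?m v) \<in> (adjacency ?H A)\<^sup>*" for u v
    using pull[OF that] collapse sym by (meson rtrancl_trans)
  then have "(u, v) \<in> connected_rel G (insert e A) \<longleftrightarrow> (?m u, ?m v) \<in> connected_rel ?H A"
    if "u \<in> verts G" "v \<in> verts G" for u v
    using that push by (auto simp: connected_rel_def H)
  then have "num_components G (insert e A) =
      card ((\<lambda>u. connected_rel ?H A `` {?m u}) ` verts G)"
    by (intro num_components_eq_card_image) (simp add: eq_equiv_class_iff[OF equiv_connected_rel] H)
  also have "(\<lambda>u. connected_rel ?H A `` {?m u}) ` verts G = verts ?H // connected_rel ?H A"
    by (auto simp: quotient_def H)
  finally show ?thesis by (simp add: num_components_def)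
qed

text \<open>The Fortuin-Kasteleyn (random cluster) sum, with weight \<open>x\<close> for an edge
  present, \<open>y\<close> for an edge absent and \<open>t\<close> for each component.\<close>

definition subset_expansion :: "('v, 'e) mgraph \<Rightarrow> poly_txy" where
  "subset_expansion G = (\<Sum>A\<in>Pow (edges G).
     var_x ^ card A * var_y ^ (card (edges G) - card A) * var_t ^ num_components G A)"

lemma finite_mgraph_delete: "finite_mgraph G \<Longrightarrow> finite_mgraph (delete_edge G e)"
  by (auto simp: finite_mgraph_def delete_edge_def)

lemma finite_mgraph_contract:
  assumes "finite_mgraph G"
  shows "finite_mgraph (contract_edge G e)"
proof -
  have "\<exists>u\<in>verts G. \<exists>v\<in>verts G. merge_ends G e ` ends G f = {merge_ends G e u, merge_ends G e v}"
    if "f \<in> edges G" for f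
  proof -
    obtain u v where "u \<in> verts G" "v \<in> verts G" "ends G f = {u, v}"
      using assms \<open>f \<in> edges G\<close> by (auto simp: finite_mgraph_def)
    then show ?thesis by force
  qed
  then show ?thesis
    using assms by (auto simp: finite_mgraph_def contract_edge_def)
qed

lemma subset_expansion_edgeless:
  "edges G = {} \<Longrightarrow> subset_expansion G = var_t ^ card (verts G)"
  by (simp add: subset_expansion_def num_components_empty)

text \<open>Edge subsets are split by whether they contain \<open>e\<close>. Those containing
  \<open>e\<close> correspond to subsets of the contraction with an extra factor \<open>x\<close>,
  the others to subsets of the deletion with an extra factor \<open>y\<close>.\<close>

lemma subset_expansion_recursion:
  assumes G: "finite_mgraph G" "e \<in> edges G"
  shows "subset_expansion G =
    var_x * subset_expansion (contract_edge G e) + var_y * subset_expansion (delete_edge G e)"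
proof -
  define E where "E = edges G - {e}"
  let ?f = "\<lambda>A. var_x ^ card A * var_y ^ (card (edges G) - card A) * var_t ^ num_components G A"
  have E: "finite E" "e \<notin> E" "edges G = insert e E"
    and edges: "edges (contract_edge G e) = E" "edges (delete_edge G e) = E"
    using G by (auto simp: E_def finite_mgraph_def contract_edge_def delete_edge_def)
  have card: "finite A" "card A \<le> card E" "e \<notin> A" if "A \<in> Pow E" for A
    using that E by (auto intro: finite_subset card_mono)
  have inj: "inj_on (insert e) (Pow E)"
    using E by (auto simp: inj_on_def)
  have "subset_expansion G = sum ?f (Pow E \<union> insert e ` Pow E)"
    by (simp add: subset_expansion_def E(3) Pow_insert)
  also have "\<dots> = sum ?f (Pow E) + sum ?f (insert e ` Pow E)"
    using E by (intro sum.union_disjoint) auto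
  also have "sum ?f (insert e ` Pow E) = (\<Sum>A\<in>Pow E. ?f (insert e A))"
    using inj by (simp add: sum.reindex)
  also have "\<dots> = var_x * subset_expansion (contract_edge G e)"
    unfolding subset_expansion_def sum_distrib_left edges
  proof (rule sum.cong)
    fix A assume A: "A \<in> Pow E"
    then have "num_components (contract_edge G e) A = num_components G (insert e A)"
      using E G by (intro num_components_contract) auto
    then show "?f (insert e A) = var_x * (var_x ^ card A *
        var_y ^ (card E - card A) * var_t ^ num_components (contract_edge G e) A)"
      using E card[OF A] by (simp add: mult.assoc)
  qed simp
  also have "sum ?f (Pow E) = var_y * subset_expansion (delete_edge G e)"
    unfolding subset_expansion_def sum_distrib_left edges
  proof (rule sum.cong)
    fix A assume "A \<in> Pow E"
    \<comment> \<open>Since \<open>card A \<le> card E\<close>, the truncated difference grows by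
      exactly one when \<open>e\<close> is counted as absent; this is the extra
      \<open>var_y\<close>.\<close>
    then show "?f A = var_y * (var_x ^ card A *
        var_y ^ (card E - card A) * var_t ^ num_components (delete_edge G e) A)"
      using E card by (simp add: num_components_delete Suc_diff_le mult.left_commute mult.assoc)
  qed simp
  finally show ?thesis by (simp only: add.commute)
qed

lemma is_negami_subset_expansion: "is_negami subset_expansion"
  by (simp add: is_negami_def subset_expansion_edgeless subset_expansion_recursion)

text \<open>Induction on the number of edges: contraction and deletion each remove exactly one edge
  and keep the multigraph finite.\<close>

lemma is_negami_unique:
  assumes "is_negami f" "finite_mgraph G"
  shows "f G = subset_expansion G"
  using assms(2)
proof (induction "card (edges G)" arbitrary: G)
  case 0
  then have "edges G = {}" by (simp add: finite_mgraph_def)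
  then show ?case
    using 0 assms(1) by (simp add: is_negami_def subset_expansion_edgeless)
next
  case (Suc n)
  then obtain e where e: "e \<in> edges G" by (metis card.empty ex_in_conv nat.distinct(1))
  then have n: "n = card (edges G - {e})"
    using Suc.hyps(2) by simp
  have "f (contract_edge G e) = subset_expansion (contract_edge G e)"
    using n Suc.prems by (intro Suc.hyps(1) finite_mgraph_contract) (simp_all add: contract_edge_def)
  moreover have "f (delete_edge G e) = subset_expansion (delete_edge G e)"
    using n Suc.prems by (intro Suc.hyps(1) finite_mgraph_delete) (simp_all add: delete_edge_def)
  ultimately show ?case
    using assms(1) Suc.prems e by (simp add: is_negami_def subset_expansion_recursion[of G e])
qed

lemma negami_eq_subset_expansion:
  assumes "finite_mgraph G"
  shows "negami G = subset_expansion G"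
  unfolding negami_def
proof (rule the_equality)
  show "\<exists>f. is_negami f \<and> f G = subset_expansion G"
    using is_negami_subset_expansion by blast
next
  fix p assume "\<exists>f. is_negami f \<and> f G = p"
  then show "p = subset_expansion G"
    using is_negami_unique[OF _ assms] by blast
qed

section \<open>The triangle\<close>

lemma finite_mgraph_triangle: "finite_mgraph triangle"
proof -
  have "\<exists>u\<in>verts triangle. \<exists>v\<in>verts triangle. ends triangle e = {u, v}" if "e \<in> edges triangle" for e
  proof (intro bexI)
    show "ends triangle e = {e, (e + 1) mod 3}" by (simp add: triangle_def)
    show "e \<in> verts triangle" using that by (simp add: triangle_def)
    show "(e + 1) mod 3 \<in> verts triangle" using that by (auto simp: triangle_def)
  qed
  then show ?thesis by (simp add: finite_mgraph_def triangle_def)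
qed

text \<open>One edge merges two of the three vertices, and any two edges already connect all of
  them.\<close>

lemma num_components_triangle:
  assumes "A \<subseteq> {0, 1, 2}"
  shows "num_components triangle A = 3 - min 2 (card A)"
proof -
  have ends: "ends triangle 0 = {0, 1}" "ends triangle (Suc 0) = {1, 2}" "ends triangle 2 = {2, 0}"
    by (auto simp: triangle_def numeral_2_eq_2)
  have verts: "verts triangle = {0, 1, 2}" by (simp add: triangle_def)
  have adj: "(u, v) \<in> adjacency triangle A" "(v, u) \<in> adjacency triangle A"
    if "e \<in> A" "ends triangle e = {u, v}" for e u v
    using that by (auto simp: insert_commute)
  have one: "num_components triangle A = 1" if *: "\<And>u. u \<in> {0, 1, 2} \<Longrightarrow> (u, 0) \<in> (adjacency triangle A)\<^sup>*"
    using num_components_eq_card_representatives[of A triangle "\<lambda>_. 0"] * by (simp add: verts)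
  \<comment> \<open>The last three cases overlap and together cover all sets with at least two
    edges.\<close>
  consider "A = {}" | "A = {0}" | "A = {1}" | "A = {2}" | "{0, 1} \<subseteq> A" | "{1, 2} \<subseteq> A" | "{0, 2} \<subseteq> A"
    using assms by auto
  then show ?thesis
  proof cases
    case 1
    then show ?thesis by (simp add: num_components_empty verts)
  next
    case 2
    \<comment> \<open>The labelling sends one end of the single edge to the other and fixes the
      remaining vertices; the next two cases do the same.\<close>
    then have "num_components triangle A = card ((\<lambda>v. if v = 1 then 0 else v) ` verts triangle)"
      using adj[of 0 0 1]
      by (intro num_components_eq_card_representatives) (auto simp: ends doubleton_eq_iff)
    then show ?thesis using 2 by (simp add: verts card_insert_if)
  next
    case 3
    then have "num_components triangle A = card ((\<lambda>v. if v = 2 then 1 else v) ` verts triangle)"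
      using adj[of 1 1 2]
      by (intro num_components_eq_card_representatives) (auto simp: ends doubleton_eq_iff)
    then show ?thesis using 3 by (simp add: verts card_insert_if)
  next
    case 4
    then have "num_components triangle A = card ((\<lambda>v. if v = 2 then 0 else v) ` verts triangle)"
      using adj[of 2 2 0]
      by (intro num_components_eq_card_representatives) (auto simp: ends doubleton_eq_iff)
    then show ?thesis using 4 by (simp add: verts card_insert_if)
  next
    case 5
    then have "(1, 0) \<in> adjacency triangle A" "(2, 1) \<in> adjacency triangle A"
      using adj[of 0 0 1] adj[of 1 1 2] by (simp_all add: ends)
    then have "num_components triangle A = 1"
      by (intro one) (auto intro: rtrancl_trans[OF r_into_rtrancl r_into_rtrancl])
    \<comment> \<open>The bound \<open>2 \<le> card A\<close> suffices, because the minimum with 2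
      is then 2.\<close>
    moreover have "card {0::nat, 1} \<le> card A" using 5 assms by (intro card_mono) (auto intro: finite_subset)
    ultimately show ?thesis by simp
  next
    case 6
    then have "(2, 0) \<in> adjacency triangle A" "(1, 2) \<in> adjacency triangle A"
      using adj[of 2 2 0] adj[of 1 1 2] by (simp_all add: ends)
    then have "num_components triangle A = 1"
      by (intro one) (auto intro: rtrancl_trans[OF r_into_rtrancl r_into_rtrancl])
    moreover have "card {1::nat, 2} \<le> card A" using 6 assms by (intro card_mono) (auto intro: finite_subset)
    ultimately show ?thesis by simp
  next
    case 7
    then have "(2, 0) \<in> adjacency triangle A" "(1, 0) \<in> adjacency triangle A"
      using adj[of 2 2 0] adj[of 0 0 1] by (simp_all add: ends)
    then have "num_components triangle A = 1"
      by (intro one) auto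
    moreover have "card {0::nat, 2} \<le> card A" using 7 assms by (intro card_mono) (auto intro: finite_subset)
    ultimately show ?thesis by simp
  qed
qed

lemma graph_rank_triangle: "A \<subseteq> {0, 1, 2} \<Longrightarrow> graph_rank triangle A = min 2 (card A)"
  unfolding graph_rank_def by (subst num_components_triangle) (auto simp: triangle_def)

section \<open>Explicit polynomials from sums over edge sets\<close>

text \<open>For the triangle, both sums depend on an edge set only through its size, so grouping by
  size leaves four terms with binomial coefficients.\<close>

lemma sum_Pow_card:
  fixes g :: "nat \<Rightarrow> 'a::comm_semiring_1"
  assumes "finite E"
  shows "(\<Sum>A\<in>Pow E. g (card A)) = (\<Sum>k\<le>card E. of_nat (card E choose k) * g k)"
proof -
  have "(\<Sum>A\<in>Pow E. g (card A)) = (\<Sum>k\<le>card E. \<Sum>A\<in>{A \<in> Pow E. card A = k}. g (card A))"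
    using assms by (intro sum.group[symmetric]) (auto intro: card_mono)
  also have "\<dots> = (\<Sum>k\<le>card E. of_nat (card E choose k) * g k)"
    using n_subsets[OF assms] by (intro sum.cong) simp_all
  finally show ?thesis .
qed

lemma negami_triangle:
  "negami triangle = var_t ^ 3 * var_y ^ 3 + 3 * var_t ^ 2 * var_x * var_y ^ 2 +
     3 * var_t * var_x ^ 2 * var_y + var_t * var_x ^ 3"
proof -
  have edges: "edges triangle = {0, 1, 2}" "finite (edges triangle)" "card (edges triangle) = 3"
    by (simp_all add: triangle_def)
  have "negami triangle = (\<Sum>A\<in>Pow (edges triangle).
      var_x ^ card A * var_y ^ (3 - card A) * var_t ^ (3 - min 2 (card A)))"
    unfolding negami_eq_subset_expansion[OF finite_mgraph_triangle] subset_expansion_def edges(3)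
    by (intro sum.cong) (simp_all add: num_components_triangle edges(1))
  also have "\<dots> = (\<Sum>k\<le>3. of_nat (3 choose k) * (var_x ^ k * var_y ^ (3 - k) * var_t ^ (3 - min 2 k)))"
    using sum_Pow_card[OF edges(2), of "\<lambda>k. var_x ^ k * var_y ^ (3 - k) * var_t ^ (3 - min 2 k)"]
    by (simp only: edges(3))
  finally show ?thesis
    by (simp add: numeral_3_eq_3 numeral_2_eq_2 binomial_Suc_Suc algebra_simps)
qed

lemma eval_us_triangle:
  fixes a b :: "'a::comm_ring_1"
  shows "eval_us (1 + 3 * var_u * var_s + 3 * var_u ^ 2 * var_s ^ 2 + var_u ^ 2 * var_s ^ 3) a b =
    1 + 3 * a * b + 3 * a ^ 2 * b ^ 2 + a ^ 2 * b ^ 3"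
proof -
  \<comment> \<open>The outer list holds the coefficients of the powers of \<open>u\<close>, each a
    polynomial in \<open>s\<close>; in this form the evaluation unfolds constructor by
    constructor.\<close>
  have "1 + 3 * var_u * var_s + 3 * var_u ^ 2 * var_s ^ 2 + var_u ^ 2 * var_s ^ 3 =
      [:1, [:0, 3:], [:0, 0, 3, 1:]:]"
    by (simp add: var_u_def var_s_def power2_eq_square power3_eq_cube one_pCons numeral_poly)
  then show ?thesis
    by (simp add: eval_us_def map_poly_pCons one_pCons power2_eq_square power3_eq_cube algebra_simps)
qed

lemma hilbert_poly_triangle:
  "hilbert_poly TYPE('k::field) triangle =
     1 + 3 * var_u * var_s + 3 * var_u ^ 2 * var_s ^ 2 + var_u ^ 2 * var_s ^ 3"
proof -
  have edges: "edges triangle = {0, 1, 2}" "finite (edges triangle)" "card (edges triangle) = 3"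
    by (simp_all add: triangle_def)
  have "hilbert_poly TYPE('k) triangle = (\<Sum>A\<in>Pow (edges triangle). var_u ^ min 2 (card A) * var_s ^ card A)"
    unfolding hilbert_poly_eq_sum[OF edges(2)]
    by (intro sum.cong) (simp_all add: graph_rank_triangle edges(1))
  also have "\<dots> = (\<Sum>k\<le>3. of_nat (3 choose k) * (var_u ^ min 2 k * var_s ^ k))"
    using sum_Pow_card[OF edges(2), of "\<lambda>k. var_u ^ min 2 k * var_s ^ k"] by (simp only: edges(3))
  finally show ?thesis
    by (simp add: numeral_3_eq_3 numeral_2_eq_2 binomial_Suc_Suc algebra_simps)
qed


theorem proposition9p3:
  shows "hilbert_poly TYPE('k::field) triangle =
           1 + 3 * var_u * var_s + 3 * var_u ^ 2 * var_s ^ 2 + var_u ^ 2 * var_s ^ 3 \<and>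
         to_fract (negami triangle) =
           to_fract var_t ^ 3 * to_fract var_y ^ 3 *
           eval_us (hilbert_poly TYPE('k) triangle)
             (inverse (to_fract var_t)) (to_fract var_x / to_fract var_y)"
proof
  show H: "hilbert_poly TYPE('k) triangle =
      1 + 3 * var_u * var_s + 3 * var_u ^ 2 * var_s ^ 2 + var_u ^ 2 * var_s ^ 3"
    by (rule hilbert_poly_triangle)
  \<comment> \<open>Both are denominators in the substitution, which takes place in the fraction
    field.\<close>
  have nz: "to_fract var_t \<noteq> 0" "to_fract var_y \<noteq> 0"
    by (simp_all add: var_t_def var_y_def)
  have power: "to_fract (p ^ n) = to_fract p ^ n" for p :: poly_txy and n
    by (induction n) simp_all
  \<comment> \<open>The numeral is carried through the embedding as a sum of ones.\<close>
  have three: "to_fract (3 :: poly_txy) = 3"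
  proof -
    have "to_fract (1 + 1 + 1 :: poly_txy) = 1 + 1 + 1"
      by (simp only: to_fract_add to_fract_1)
    then show ?thesis by simp
  qed
  \<comment> \<open>A term \<open>u^p s^d\<close> turns into \<open>t^(3-p) x^d y^(3-d)\<close>
    after multiplication by the prefactor, so clearing denominators matches the explicit polynomials
    term by term.\<close>
  show "to_fract (negami triangle) =
      to_fract var_t ^ 3 * to_fract var_y ^ 3 *
      eval_us (hilbert_poly TYPE('k) triangle)
        (inverse (to_fract var_t)) (to_fract var_x / to_fract var_y)"
    unfolding H eval_us_triangle negami_triangle
    using nz by (simp add: power three field_simps power2_eq_square power3_eq_cube)
qed

end
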